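(* Let $0<r<1$ and let $T$ be an invertible bounded linear operator on a Hilbert space. Then $T$ is in $\mathbf{C}_\alpha$ if and only if $T^*$ is unitarily equivalent to a compression, to a coinvariant subspace, of an operator of the form $$(M_z\text{ on }H^2_r(\mathbb{A},E))\oplus U_0\oplus rU_1,$$ where $E$ is a Hilbert space, and $U_0$ and $U_1$ are unitary operators.
   Context: $\mathbf{C}_\alpha$ is the class of all invertible bounded Hilbert space operators $T$ such that $\alpha(T^*,T):=-T^{*2}T^2+(1+r^2)T^*T-r^2I\ge0$. $\mathbb{A}=\{r<|z|<1\}$. For a Hilbert space $E$, $H^2_r(\mathbb{A},E)$ is the Hilbert space of analytic functions $g:\mathbb{A}\to E$ with Laurent expansion $g(z)=\sum_{n\in\mathbb{Z}}g_nz^n$ and finite norm $$\|g\|^2_{H^2_r(\mathbb{A},E)}=(1-r^2)\Big(\sum_{n=0}^\infty\|g_n\|^2+\sum_{n=-\infty}^{-1}r^{2n+2}\|g_n\|^2\Big),$$ and $M_zg(z)=zg(z)$. For an operator $X$ on $K$, a closed subspace $L\subset K$ is coinvariant if $X^*L\subset L$; the compression of $X$ to $L$ is $P_LX|_L$, with $P_L$ the orthogonal projection onto $L$. The unitary operators may act on zero spaces. *)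

theory Defs
  imports "HOL-Analysis.Analysis" "HOL-Library.Function_Algebras"
begin

section \<open>Complex vector spaces and Hilbert spaces\<close>

class scaleC =
  fixes scaleC :: "complex \<Rightarrow> 'a \<Rightarrow> 'a"  (infixr \<open>*\<^sub>C\<close> 75)

class complex_vector = ab_group_add + scaleC +
  assumes scaleC_add_right: "c *\<^sub>C (x + y) = c *\<^sub>C x + c *\<^sub>C y"
    and scaleC_add_left: "(c + d) *\<^sub>C x = c *\<^sub>C x + d *\<^sub>C x"
    and scaleC_scaleC: "c *\<^sub>C (d *\<^sub>C x) = (c * d) *\<^sub>C x"
    and scaleC_one: "1 *\<^sub>C x = x"

text \<open>The inner product is linear in its first argument. The class \<^class>\<open>banach\<close> supplies
  the topology and completeness; definiteness of the inner product follows from the last axiom.\<close>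

class chilbert_space = complex_vector + banach +
  fixes cinner :: "'a \<Rightarrow> 'a \<Rightarrow> complex"
  assumes scaleR_scaleC: "scaleR a x = scaleC (complex_of_real a) x"
    and cinner_commute: "cinner x y = cnj (cinner y x)"
    and cinner_add_left: "cinner (x + y) z = cinner x z + cinner y z"
    and cinner_scaleC_left: "cinner (c *\<^sub>C x) y = c * cinner x y"
    and cinner_norm: "cinner x x = complex_of_real ((norm x)\<^sup>2)"

instantiation complex :: chilbert_space
begin
definition scaleC_complex :: "complex \<Rightarrow> complex \<Rightarrow> complex" where "scaleC_complex c x = c * x"
definition cinner_complex :: "complex \<Rightarrow> complex \<Rightarrow> complex" where "cinner_complex x y = x * cnj y"
instance
  by standard
    (auto simp: scaleC_complex_def cinner_complex_def algebra_simps scaleR_conv_of_real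
      complex_norm_square simp flip: of_real_power)
end

instantiation prod :: (complex_vector, complex_vector) complex_vector
begin
definition scaleC_prod :: "complex \<Rightarrow> 'a \<times> 'b \<Rightarrow> 'a \<times> 'b"
  where "scaleC_prod c p = (c *\<^sub>C fst p, c *\<^sub>C snd p)"
instance
  by standard
    (auto simp: scaleC_prod_def scaleC_add_right scaleC_add_left scaleC_scaleC scaleC_one)
end

instantiation "fun" :: (type, complex_vector) complex_vector
begin
definition scaleC_fun :: "complex \<Rightarrow> ('a \<Rightarrow> 'b) \<Rightarrow> 'a \<Rightarrow> 'b"
  where "scaleC_fun c f = (\<lambda>x. c *\<^sub>C f x)"
instance
  by standard
    (auto simp: scaleC_fun_def scaleC_add_right scaleC_add_left scaleC_scaleC scaleC_one)
end

definition csubspace :: "'a::complex_vector set \<Rightarrow> bool" where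
  "csubspace S \<longleftrightarrow>
     0 \<in> S \<and> (\<forall>x\<in>S. \<forall>y\<in>S. x + y \<in> S) \<and> (\<forall>c. \<forall>x\<in>S. c *\<^sub>C x \<in> S)"

text \<open>The model spaces (vector-valued Hardy spaces, direct sums, closed subspaces of these) are
  given by a carrier in an ambient complex vector space together with an inner product, which is
  only meaningful on the carrier. Likewise, operators on such a space are functions on the ambient
  type of which only the values on the carrier matter.\<close>

record 'a hspace =
  hcarrier :: "'a set"
  hinner :: "'a \<Rightarrow> 'a \<Rightarrow> complex"

definition hnorm :: "'a hspace \<Rightarrow> 'a \<Rightarrow> real" where
  "hnorm H x = sqrt (Re (hinner H x x))"

definition sub_hspace :: "'a hspace \<Rightarrow> 'a set \<Rightarrow> 'a hspace" where
  "sub_hspace H L = \<lparr>hcarrier = L, hinner = hinner H\<rparr>"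

text \<open>For a closed subspace \<open>V\<close> of a type of class \<^class>\<open>chilbert_space\<close> this is a Hilbert space;
  \<open>hspace_of UNIV\<close> is the space of all elements of the type.\<close>

definition hspace_of :: "'a::chilbert_space set \<Rightarrow> 'a hspace" where
  "hspace_of V = \<lparr>hcarrier = V, hinner = cinner\<rparr>"

definition hilbert_subset :: "'a::chilbert_space set \<Rightarrow> bool" where
  "hilbert_subset V \<longleftrightarrow> csubspace V \<and> closed V"

definition direct_sum :: "'a hspace \<Rightarrow> 'b hspace \<Rightarrow> ('a \<times> 'b) hspace"  (infixr \<open>\<oplus>\<^sub>H\<close> 65) where
  "H \<oplus>\<^sub>H K = \<lparr>hcarrier = hcarrier H \<times> hcarrier K,
     hinner = (\<lambda>p q. hinner H (fst p) (fst q) + hinner K (snd p) (snd q))\<rparr>"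

section \<open>Operators\<close>

definition unitary_map ::
  "'a::complex_vector hspace \<Rightarrow> 'b::complex_vector hspace \<Rightarrow> ('a \<Rightarrow> 'b) \<Rightarrow> bool" where
  "unitary_map H K V \<longleftrightarrow>
     bij_betw V (hcarrier H) (hcarrier K) \<and>
     (\<forall>x\<in>hcarrier H. \<forall>y\<in>hcarrier H. V (x + y) = V x + V y) \<and>
     (\<forall>c. \<forall>x\<in>hcarrier H. V (c *\<^sub>C x) = c *\<^sub>C V x) \<and>
     (\<forall>x\<in>hcarrier H. \<forall>y\<in>hcarrier H. hinner K (V x) (V y) = hinner H x y)"

definition unitarily_equivalent ::
  "'a::complex_vector hspace \<Rightarrow> ('a \<Rightarrow> 'a) \<Rightarrow> 'b::complex_vector hspace \<Rightarrow> ('b \<Rightarrow> 'b) \<Rightarrow> bool" where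
  "unitarily_equivalent H X K Y \<longleftrightarrow>
     (\<exists>V. unitary_map H K V \<and> (\<forall>x\<in>hcarrier H. V (X x) = Y (V x)))"

definition hadjoint :: "'a hspace \<Rightarrow> ('a \<Rightarrow> 'a) \<Rightarrow> 'a \<Rightarrow> 'a" where
  "hadjoint H X y =
     (THE z. z \<in> hcarrier H \<and> (\<forall>x\<in>hcarrier H. hinner H (X x) y = hinner H x z))"

definition closed_subspace :: "'a::complex_vector hspace \<Rightarrow> 'a set \<Rightarrow> bool" where
  "closed_subspace H L \<longleftrightarrow>
     L \<subseteq> hcarrier H \<and> csubspace L \<and>
     (\<forall>u l. (\<forall>n::nat. u n \<in> L) \<and> l \<in> hcarrier H \<and> (\<lambda>n. hnorm H (u n - l)) \<longlonglongrightarrow> 0 \<longrightarrow> l \<in> L)"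

definition orth_proj :: "'a::complex_vector hspace \<Rightarrow> 'a set \<Rightarrow> 'a \<Rightarrow> 'a" where
  "orth_proj H L x = (THE y. y \<in> L \<and> (\<forall>z\<in>L. hinner H (x - y) z = 0))"

definition coinvariant :: "'a hspace \<Rightarrow> ('a \<Rightarrow> 'a) \<Rightarrow> 'a set \<Rightarrow> bool" where
  "coinvariant H X L \<longleftrightarrow> hadjoint H X ` L \<subseteq> L"

definition compression :: "'a::complex_vector hspace \<Rightarrow> 'a set \<Rightarrow> ('a \<Rightarrow> 'a) \<Rightarrow> 'a \<Rightarrow> 'a" where
  "compression H L X x = orth_proj H L (X x)"

definition bounded_clinear :: "('a::chilbert_space \<Rightarrow> 'a) \<Rightarrow> bool" where
  "bounded_clinear T \<longleftrightarrow> bounded_linear T \<and> (\<forall>c x. T (c *\<^sub>C x) = c *\<^sub>C T x)"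

definition invertible_op :: "('a::chilbert_space \<Rightarrow> 'a) \<Rightarrow> bool" where
  "invertible_op T \<longleftrightarrow>
     bounded_clinear T \<and> (\<exists>S. bounded_clinear S \<and> S \<circ> T = id \<and> T \<circ> S = id)"

abbreviation adj :: "('a::chilbert_space \<Rightarrow> 'a) \<Rightarrow> 'a \<Rightarrow> 'a" where
  "adj T \<equiv> hadjoint (hspace_of UNIV) T"

definition positive_op :: "('a::chilbert_space \<Rightarrow> 'a) \<Rightarrow> bool" where
  "positive_op A \<longleftrightarrow> (\<forall>x. Im (cinner (A x) x) = 0 \<and> 0 \<le> Re (cinner (A x) x))"

definition alpha_op :: "real \<Rightarrow> ('a::chilbert_space \<Rightarrow> 'a) \<Rightarrow> 'a \<Rightarrow> 'a" where
  "alpha_op r T x =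
     - adj T (adj T (T (T x))) + (1 + r\<^sup>2) *\<^sub>R adj T (T x) - r\<^sup>2 *\<^sub>R x"

definition C_alpha :: "real \<Rightarrow> ('a::chilbert_space \<Rightarrow> 'a) set" where
  "C_alpha r = {T. invertible_op T \<and> positive_op (alpha_op r T)}"

section \<open>The Hardy space of the annulus\<close>

definition annulus :: "real \<Rightarrow> complex set" where
  "annulus r = {z. r < norm z \<and> norm z < 1}"

definition analytic_vec :: "complex set \<Rightarrow> (complex \<Rightarrow> 'e::chilbert_space) \<Rightarrow> bool" where
  "analytic_vec A g \<longleftrightarrow> (\<forall>z\<in>A. \<exists>d. (g has_derivative (\<lambda>h. h *\<^sub>C d)) (at z))"

definition laurent_expansion ::
  "real \<Rightarrow> (complex \<Rightarrow> 'e::chilbert_space) \<Rightarrow> (int \<Rightarrow> 'e) \<Rightarrow> bool" where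
  "laurent_expansion r g c \<longleftrightarrow>
     (\<forall>z\<in>annulus r. ((\<lambda>n. (z powi n) *\<^sub>C c n) has_sum g z) UNIV)"

definition laurent_coeff :: "real \<Rightarrow> (complex \<Rightarrow> 'e::chilbert_space) \<Rightarrow> int \<Rightarrow> 'e" where
  "laurent_coeff r g = (THE c. laurent_expansion r g c)"

definition hardy_weight :: "real \<Rightarrow> int \<Rightarrow> real" where
  "hardy_weight r n = (1 - r\<^sup>2) * (if n \<ge> 0 then 1 else r powi (2 * n + 2))"

text \<open>Functions on the annulus are represented by functions vanishing outside of it.
  The inner product is the one obtained from the norm
  \<open>\<parallel>g\<parallel>\<^sup>2 = (\<Sum>n. hardy_weight r n * \<parallel>g\<^sub>n\<parallel>\<^sup>2)\<close> by polarization.\<close>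

definition hardy_space :: "real \<Rightarrow> 'e::chilbert_space set \<Rightarrow> (complex \<Rightarrow> 'e) hspace" where
  "hardy_space r E =
     \<lparr>hcarrier = {g. (\<forall>z. z \<notin> annulus r \<longrightarrow> g z = 0) \<and> (\<forall>z\<in>annulus r. g z \<in> E) \<and>
        analytic_vec (annulus r) g \<and>
        (\<exists>c. (\<forall>n. c n \<in> E) \<and> laurent_expansion r g c \<and>
          (\<lambda>n. hardy_weight r n * (norm (c n))\<^sup>2) summable_on UNIV)},
      hinner = (\<lambda>f g. \<Sum>\<^sub>\<infinity>n\<in>UNIV. complex_of_real (hardy_weight r n) *
        cinner (laurent_coeff r f n) (laurent_coeff r g n))\<rparr>"

definition mult_z :: "(complex \<Rightarrow> 'e::complex_vector) \<Rightarrow> complex \<Rightarrow> 'e" where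
  "mult_z g = (\<lambda>z. z *\<^sub>C g z)"

definition model_space ::
  "real \<Rightarrow> 'e::chilbert_space set \<Rightarrow> 'k::chilbert_space set \<Rightarrow> 'l::chilbert_space set
    \<Rightarrow> ((complex \<Rightarrow> 'e) \<times> 'k \<times> 'l) hspace" where
  "model_space r E K\<^sub>0 K\<^sub>1 = hardy_space r E \<oplus>\<^sub>H hspace_of K\<^sub>0 \<oplus>\<^sub>H hspace_of K\<^sub>1"

definition model_op ::
  "real \<Rightarrow> ('k::chilbert_space \<Rightarrow> 'k) \<Rightarrow> ('l::chilbert_space \<Rightarrow> 'l)
    \<Rightarrow> (complex \<Rightarrow> 'e::chilbert_space) \<times> 'k \<times> 'l \<Rightarrow> (complex \<Rightarrow> 'e) \<times> 'k \<times> 'l" where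
  "model_op r U\<^sub>0 U\<^sub>1 = map_prod mult_z (map_prod U\<^sub>0 (\<lambda>y. r *\<^sub>R U\<^sub>1 y))"

text \<open>Hilbert spaces \<open>E\<close>, \<open>K\<^sub>0\<close>, \<open>K\<^sub>1\<close> (possibly zero) are presented as closed subspaces of types of
  class \<^class>\<open>chilbert_space\<close>, so that one can quantify over them inside a formula. Here \<open>S\<close> is an
  operator on the Hilbert space of all elements of its type.\<close>

definition compression_of_model ::
  "real \<Rightarrow> ('a::chilbert_space \<Rightarrow> 'a) \<Rightarrow> 'e::chilbert_space set
    \<Rightarrow> 'k::chilbert_space set \<Rightarrow> ('k \<Rightarrow> 'k) \<Rightarrow> 'l::chilbert_space set \<Rightarrow> ('l \<Rightarrow> 'l) \<Rightarrow> bool" where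
  "compression_of_model r S E K\<^sub>0 U\<^sub>0 K\<^sub>1 U\<^sub>1 \<longleftrightarrow>
     hilbert_subset E \<and> hilbert_subset K\<^sub>0 \<and> hilbert_subset K\<^sub>1 \<and>
     unitary_map (hspace_of K\<^sub>0) (hspace_of K\<^sub>0) U\<^sub>0 \<and>
     unitary_map (hspace_of K\<^sub>1) (hspace_of K\<^sub>1) U\<^sub>1 \<and>
     (let H = model_space r E K\<^sub>0 K\<^sub>1; M = model_op r U\<^sub>0 U\<^sub>1 in
       \<exists>L. closed_subspace H L \<and> coinvariant H M L \<and>
         unitarily_equivalent (hspace_of UNIV) S (sub_hspace H L) (compression H L M))"

end

theory Submission
  imports Defs
begin

text \<open>
  Write \<open>\<delta>(x) = \<langle>\<alpha>(T\<^sup>*, T) x, x\<rangle> = - \<parallel>T\<^sup>2 x\<parallel>\<^sup>2 + (1 + r\<^sup>2) \<parallel>T x\<parallel>\<^sup>2 - r\<^sup>2 \<parallel>x\<parallel>\<^sup>2\<close>, called the defect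
  below. Passing to adjoints, \<open>T\<^sup>*\<close> is a compression of the model operator \<open>M\<close> to a coinvariant
  subspace if and only if there is a linear isometry \<open>V\<close> into the model space with
  \<open>V T = M\<^sup>* V\<close> (\<open>compression_iff_intertwining_isometry\<close>).

  Given such a \<open>V\<close>, the defect of \<open>T\<close> at \<open>x\<close> is the defect of \<open>M\<^sup>*\<close> at \<open>V x\<close>. It vanishes on the parts
  \<open>U\<^sub>0\<close> and \<open>r U\<^sub>1\<close>. On the Hardy space with weights \<open>w\<^sub>n\<close> the numbers \<open>1 / w\<^sub>n\<close> solve, away from
  \<open>n = 0\<close>, the recurrence given by \<open>\<alpha>\<close>, so that only a multiple of \<open>\<parallel>g\<^sub>0\<parallel>\<^sup>2\<close> remains
  (\<open>hardy_norm_sq_defect\<close>).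

  Conversely let \<open>\<delta> \<ge> 0\<close>. Following the orbit of \<open>x\<close> forwards and backwards shows
  \<open>r \<parallel>x\<parallel> \<le> \<parallel>T x\<parallel> \<le> \<parallel>x\<parallel>\<close>. Hence \<open>\<parallel>T\<^sup>n x\<parallel>\<^sup>2\<close> and \<open>r\<^sup>2\<^sup>n \<parallel>T\<^sup>-\<^sup>n x\<parallel>\<^sup>2\<close> decrease to limits
  \<open>\<parallel>C\<^sub>0 x\<parallel>\<^sup>2\<close> and \<open>\<parallel>C\<^sub>1 x\<parallel>\<^sup>2\<close>, and \<open>T\<close> induces unitary operators on the closed ranges of \<open>C\<^sub>0\<close> and
  (after division by \<open>r\<close>) of \<open>C\<^sub>1\<close>. With \<open>\<parallel>D x\<parallel>\<^sup>2 = \<delta>(x)\<close> the sum \<open>\<Sum> \<parallel>D T\<^sup>n x\<parallel>\<^sup>2 / w\<^sub>n\<close> over all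
  integers telescopes on both sides of \<open>n = 0\<close> and equals
  \<open>\<parallel>x\<parallel>\<^sup>2 - \<parallel>C\<^sub>0 x\<parallel>\<^sup>2 - \<parallel>C\<^sub>1 x\<parallel>\<^sup>2\<close> (\<open>hardy_norm_sq_orbit\<close>). So the function with Laurent coefficients
  \<open>D T\<^sup>n x / w\<^sub>n\<close> together with \<open>C\<^sub>0 x\<close> and \<open>C\<^sub>1 x\<close> is the value of the required isometry at \<open>x\<close>.

  The operators \<open>C\<^sub>0\<close>, \<open>C\<^sub>1\<close> and \<open>D\<close> arise by writing a bounded positive form as
  \<open>\<langle>C x, C y\<rangle>\<close>, with \<open>C\<close> the square root of the operator that represents the form
  (\<open>bounded_psd_form_factorization\<close>). The elements of the Hardy space are handled through their
  coefficients, which requires that Laurent coefficients are unique and that convergent Laurent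
  series are analytic.
\<close>

section \<open>Positive semidefinite forms\<close>

lemma scaleC_zero_left [simp]: "0 *\<^sub>C (x::'a::complex_vector) = 0"
  using scaleC_add_left[of 0 0 x] by simp

lemma scaleC_zero_right [simp]: "c *\<^sub>C (0::'a::complex_vector) = 0"
  using scaleC_add_right[of c 0 "0::'a"] by simp

lemma scaleC_minus_left: "(- c) *\<^sub>C (x::'a::complex_vector) = - (c *\<^sub>C x)"
  using scaleC_add_left[of c "-c" x] by (simp add: eq_neg_iff_add_eq_0 add.commute)

lemma scaleC_minus_right: "c *\<^sub>C (- x::'a::complex_vector) = - (c *\<^sub>C x)"
  using scaleC_add_right[of c x "-x"] by (simp add: eq_neg_iff_add_eq_0 add.commute)

lemma scaleC_diff_right: "c *\<^sub>C (x - y::'a::complex_vector) = c *\<^sub>C x - c *\<^sub>C y"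
  using scaleC_add_right[of c x "-y"] by (simp add: scaleC_minus_right)

lemma minus_eq_scaleC: "- (x::'a::complex_vector) = (- 1) *\<^sub>C x"
  by (simp add: scaleC_minus_left scaleC_one)

lemma csubspace_0: "csubspace S \<Longrightarrow> 0 \<in> S"
  and csubspace_add: "csubspace S \<Longrightarrow> x \<in> S \<Longrightarrow> y \<in> S \<Longrightarrow> x + y \<in> S"
  and csubspace_scale: "csubspace S \<Longrightarrow> x \<in> S \<Longrightarrow> c *\<^sub>C x \<in> S"
  by (auto simp: csubspace_def)

lemma csubspace_minus: "csubspace S \<Longrightarrow> x \<in> S \<Longrightarrow> - x \<in> S"
  by (metis csubspace_scale minus_eq_scaleC)

lemma csubspace_diff: "csubspace S \<Longrightarrow> x \<in> S \<Longrightarrow> y \<in> S \<Longrightarrow> x - y \<in> S"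
  using csubspace_add[of S x "- y"] csubspace_minus by fastforce

lemma csubspace_UNIV [simp]: "csubspace UNIV"
  by (simp add: csubspace_def)

lemma csubspace_range:
  fixes V :: "'c::complex_vector \<Rightarrow> 'a::complex_vector"
  assumes "\<And>x y. V (x + y) = V x + V y" and "\<And>c x. V (c *\<^sub>C x) = c *\<^sub>C V x"
  shows "csubspace (range V)"
proof -
  have "V 0 = 0" using assms(2)[of 0 0] by simp
  then show ?thesis
    unfolding csubspace_def by (auto simp flip: assms intro: image_eqI[of _ _ 0])
qed

text \<open>Besides the inner products of the Hilbert spaces and of the model spaces, the locale covers
  the defect form of the operator and the limits of the forms \<open>\<langle>T\<^sup>n x, T\<^sup>n y\<rangle>\<close>; positivity is all
  that the Cauchy-Schwarz inequality needs.\<close>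

locale psd_form =
  fixes S :: "'a::complex_vector set" and f :: "'a \<Rightarrow> 'a \<Rightarrow> complex"
  assumes sub: "csubspace S"
    and add_left: "\<lbrakk>x \<in> S; y \<in> S; z \<in> S\<rbrakk> \<Longrightarrow> f (x + y) z = f x z + f y z"
    and scale_left: "\<lbrakk>x \<in> S; y \<in> S\<rbrakk> \<Longrightarrow> f (c *\<^sub>C x) y = c * f x y"
    and herm: "\<lbrakk>x \<in> S; y \<in> S\<rbrakk> \<Longrightarrow> f x y = cnj (f y x)"
    and nonneg: "x \<in> S \<Longrightarrow> 0 \<le> Re (f x x)"
begin

lemmas closed_ops = csubspace_0[OF sub] csubspace_add[OF sub] csubspace_scale[OF sub]
  csubspace_minus[OF sub] csubspace_diff[OF sub]

lemma add_right: "\<lbrakk>x \<in> S; y \<in> S; z \<in> S\<rbrakk> \<Longrightarrow> f x (y + z) = f x y + f x z"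
  by (metis add_left closed_ops(2) complex_cnj_add herm)

lemma scale_right: "\<lbrakk>x \<in> S; y \<in> S\<rbrakk> \<Longrightarrow> f x (c *\<^sub>C y) = cnj c * f x y"
  by (metis scale_left closed_ops(3) complex_cnj_mult herm)

lemma minus_left: "\<lbrakk>x \<in> S; y \<in> S\<rbrakk> \<Longrightarrow> f (- x) y = - f x y"
  using scale_left[of x y "- 1"] by (simp add: scaleC_minus_left scaleC_one)

lemma minus_right: "\<lbrakk>x \<in> S; y \<in> S\<rbrakk> \<Longrightarrow> f x (- y) = - f x y"
  using scale_right[of x y "- 1"] by (simp add: scaleC_minus_left scaleC_one)

lemma diff_left: "\<lbrakk>x \<in> S; y \<in> S; z \<in> S\<rbrakk> \<Longrightarrow> f (x - y) z = f x z - f y z"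
  using add_left[of x "-y" z] by (simp add: minus_left closed_ops)

lemma diff_right: "\<lbrakk>x \<in> S; y \<in> S; z \<in> S\<rbrakk> \<Longrightarrow> f x (y - z) = f x y - f x z"
  using add_right[of x y "-z"] by (simp add: minus_right closed_ops)

lemmas expand = add_left add_right scale_left scale_right minus_left minus_right
  diff_left diff_right closed_ops

lemma zero_left [simp]: "y \<in> S \<Longrightarrow> f 0 y = 0"
  using scale_left[of 0 y 0] closed_ops by simp

lemma zero_right [simp]: "y \<in> S \<Longrightarrow> f y 0 = 0"
  using scale_right[of y 0 0] closed_ops by simp

lemma Im_self: "x \<in> S \<Longrightarrow> Im (f x x) = 0"
  using herm[of x x] by (metis Im_complex_of_real Reals_cnj_iff complex_is_Real_iff)

lemma self_eq: "x \<in> S \<Longrightarrow> f x x = complex_of_real (Re (f x x))"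
  by (simp add: complex_eq_iff Im_self)

lemma Cauchy_Schwarz:
  assumes x: "x \<in> S" and y: "y \<in> S"
  shows "(cmod (f x y))\<^sup>2 \<le> Re (f x x) * Re (f y y)"
proof -
  let ?w = "f x y" and ?a = "Re (f x x)" and ?b = "Re (f y y)"
  \<comment> \<open>Positivity of the form on \<open>x - s w y\<close> with \<open>w = f x y\<close>, for every real \<open>s\<close>.\<close>
  have quad: "0 \<le> ?a - 2 * s * (cmod ?w)\<^sup>2 + s\<^sup>2 * (cmod ?w)\<^sup>2 * ?b" for s :: real
  proof -
    let ?c = "- (complex_of_real s * ?w)"
    have "f (x + ?c *\<^sub>C y) (x + ?c *\<^sub>C y)
        = f x x + cnj ?c * ?w + ?c * cnj ?w + ?c * cnj ?c * f y y"
      using x y herm[of y x] by (simp add: expand algebra_simps)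
    also have "\<dots> = f x x - 2 * s * (?w * cnj ?w) + s\<^sup>2 * (?w * cnj ?w) * f y y"
      by (simp add: algebra_simps power2_eq_square)
    also have "Re \<dots> = ?a - 2 * s * (cmod ?w)\<^sup>2 + s\<^sup>2 * (cmod ?w)\<^sup>2 * ?b"
      unfolding complex_norm_square[symmetric]
      by (subst (2) self_eq[OF y]) (simp flip: of_real_power of_real_mult)
    finally show ?thesis
      using nonneg[of "x + ?c *\<^sub>C y"] x y by (simp add: expand)
  qed
  show ?thesis
  proof (cases "?w = 0")
    case True
    then show ?thesis using nonneg x y by simp
  next
    case False
    show ?thesis
    proof (cases "?b = 0")
      case True
      have "2 * ((?a + 1) / (2 * (cmod ?w)\<^sup>2)) * (cmod ?w)\<^sup>2 = ?a + 1"
        using False by (simp add: field_simps)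
      then show ?thesis
        using quad[of "(?a + 1) / (2 * (cmod ?w)\<^sup>2)"] True by simp
    next
      case b: False
      then have "?b > 0" using nonneg[OF y] by simp
      then show ?thesis
        using quad[of "1 / ?b"] by (simp add: field_simps power2_eq_square)
    qed
  qed
qed

lemma hsqrt_triangle:
  assumes x: "x \<in> S" and y: "y \<in> S"
  shows "sqrt (Re (f (x + y) (x + y))) \<le> sqrt (Re (f x x)) + sqrt (Re (f y y))"
proof (rule real_le_lsqrt)
  have "Re (f x y) \<le> cmod (f x y)"
    by (rule complex_Re_le_cmod)
  also have "\<dots> \<le> sqrt (Re (f x x) * Re (f y y))"
    using Cauchy_Schwarz[OF x y] by (simp add: real_le_rsqrt)
  finally have "Re (f x y) \<le> sqrt (Re (f x x)) * sqrt (Re (f y y))"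
    by (simp add: real_sqrt_mult)
  moreover have "Re (f (x + y) (x + y)) = Re (f x x) + 2 * Re (f x y) + Re (f y y)"
    using x y herm[of y x] by (simp add: expand)
  ultimately show "Re (f (x + y) (x + y)) \<le> (sqrt (Re (f x x)) + sqrt (Re (f y y)))\<^sup>2"
    using nonneg x y by (simp add: power2_sum)
qed (use nonneg x y in simp)

lemma polarization:
  assumes x: "x \<in> S" and y: "y \<in> S"
  shows "4 * f x y = f (x + y) (x + y) - f (x - y) (x - y)
    + \<i> * f (x + \<i> *\<^sub>C y) (x + \<i> *\<^sub>C y) - \<i> * f (x - \<i> *\<^sub>C y) (x - \<i> *\<^sub>C y)"
  using x y by (simp add: expand algebra_simps)

end

section \<open>Hilbert spaces\<close>

global_interpretation cinner: psd_form UNIV "cinner :: 'a::chilbert_space \<Rightarrow> _"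

  by standard (auto simp: cinner_add_left cinner_scaleC_left cinner_norm simp flip: cinner_commute)

lemma norm_sq_cinner: "(norm (x::'a::chilbert_space))\<^sup>2 = Re (cinner x x)"
  by (simp add: cinner_norm)

lemma cinner_self_eq_0 [simp]: "cinner x x = 0 \<longleftrightarrow> x = (0::'a::chilbert_space)"
  by (simp add: cinner_norm)

lemma norm_cinner_le: "cmod (cinner x y) \<le> norm x * norm (y::'a::chilbert_space)"
  using cinner.Cauchy_Schwarz[of x y]
  by (simp add: cinner_norm power_mult_distrib[symmetric] power_mono_iff)

lemma norm_scaleC [simp]: "norm (c *\<^sub>C x) = cmod c * norm (x::'a::chilbert_space)"
proof -
  have "cinner (c *\<^sub>C x) (c *\<^sub>C x) = (c * cnj c) * cinner x x"
    by (simp add: cinner.expand)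
  then have "(norm (c *\<^sub>C x))\<^sup>2 = (cmod c * norm x)\<^sup>2"
    unfolding cinner_norm complex_norm_square[symmetric]
    by (simp only: power_mult_distrib of_real_eq_iff flip: of_real_mult of_real_power)
  then show ?thesis
    by (simp add: power2_eq_iff_nonneg)
qed

lemma cinner_scaleR_left: "cinner (a *\<^sub>R x) y = of_real a * cinner x (y::'a::chilbert_space)"
  by (simp add: scaleR_scaleC cinner_scaleC_left)

lemma cinner_scaleR_right: "cinner x (a *\<^sub>R y) = of_real a * cinner x (y::'a::chilbert_space)"
  by (simp add: scaleR_scaleC cinner.scale_right)

lemma scaleC_scaleR_commute: "c *\<^sub>C (a *\<^sub>R x) = a *\<^sub>R (c *\<^sub>C (x::'a::chilbert_space))"
  by (simp add: scaleR_scaleC scaleC_scaleC mult.commute)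

lemma bounded_bilinear_cinner:
  "bounded_bilinear (cinner :: 'a::chilbert_space \<Rightarrow> 'a \<Rightarrow> complex)"
  by standard
    (auto simp: cinner.expand cinner_scaleR_left cinner_scaleR_right scaleR_conv_of_real
      intro!: exI[of _ 1] norm_cinner_le)

lemma bounded_bilinear_scaleC:
  "bounded_bilinear (scaleC :: complex \<Rightarrow> 'a::chilbert_space \<Rightarrow> 'a)"
  by standard
    (auto simp: scaleC_add_left scaleC_add_right scaleR_scaleC scaleC_scaleC scaleC_complex_def
      mult.commute intro!: exI[of _ 1])

lemmas tendsto_cinner [tendsto_intros] = bounded_bilinear.tendsto[OF bounded_bilinear_cinner]
lemmas tendsto_scaleC [tendsto_intros] = bounded_bilinear.tendsto[OF bounded_bilinear_scaleC]

lemma norm_sq_add: "(norm (x + y))\<^sup>2 = (norm x)\<^sup>2 + 2 * Re (cinner x y) + (norm (y::'a::chilbert_space))\<^sup>2"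
  using cinner_commute[of y x] by (simp add: norm_sq_cinner cinner.expand)

lemma norm_sq_diff: "(norm (x - y))\<^sup>2 = (norm x)\<^sup>2 - 2 * Re (cinner x y) + (norm (y::'a::chilbert_space))\<^sup>2"
  using cinner_commute[of y x] by (simp add: norm_sq_cinner cinner.expand)

lemma cinner_eqI: "(\<And>x. cinner x y = cinner x z) \<Longrightarrow> y = (z::'a::chilbert_space)"
  using cinner.diff_right[of "y - z" y z] by simp

text \<open>The representing vector of \<open>\<phi>\<close> is the minimizer of \<open>\<parallel>x\<parallel>\<^sup>2 - 2 Re \<phi> x\<close>: by the parallelogram
  law a minimizing sequence is Cauchy, and stationarity at the minimum is the
  representation.\<close>

lemma Riesz_representation:
  fixes \<phi> :: "'a::chilbert_space \<Rightarrow> complex"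
  assumes add: "\<And>x y. \<phi> (x + y) = \<phi> x + \<phi> y"
    and scale: "\<And>c x. \<phi> (c *\<^sub>C x) = c * \<phi> x"
    and bound: "\<And>x. cmod (\<phi> x) \<le> K * norm x"
  shows "\<exists>y. \<forall>x. \<phi> x = cinner x y"
proof -
  have scaleR: "\<phi> (a *\<^sub>R x) = of_real a * \<phi> x" for a x
    by (simp add: scaleR_scaleC scale)
  have lin: "bounded_linear \<phi>"
    by (rule bounded_linear_intro[where K = K])
      (auto simp: add scaleR bound scaleR_conv_of_real mult.commute)
  define J where "J x = (norm x)\<^sup>2 - 2 * Re (\<phi> x)" for x
  have J_ge: "- K\<^sup>2 \<le> J x" for x
  proof -
    have "Re (\<phi> x) \<le> K * norm x"
      using bound[of x] complex_Re_le_cmod[of "\<phi> x"] by linarith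
    then show ?thesis
      using zero_le_power2[of "norm x - K"] by (simp add: J_def power2_diff mult.commute)
  qed
  define m where "m = Inf (range J)"
  have bdd: "bdd_below (range J)"
    using J_ge by (auto intro!: bdd_belowI)
  have m_le: "m \<le> J x" for x
    unfolding m_def by (rule cInf_lower[OF _ bdd]) simp
  have "\<exists>x. J x < m + 1 / real (Suc n)" for n
    using cInf_lessD[of "range J" "m + 1 / real (Suc n)"] by (auto simp: m_def)
  then obtain u where u: "\<And>n. J (u n) < m + 1 / real (Suc n)"
    by metis
  have close: "(norm (u n - u k))\<^sup>2 \<le> 2 / real (Suc n) + 2 / real (Suc k)" for n k
  proof -
    have "(norm ((1/2) *\<^sub>R (u n + u k)))\<^sup>2 = (norm (u n + u k))\<^sup>2 / 4"
      unfolding norm_scaleR by (simp add: power_mult_distrib power_divide)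
    then have "(norm (u n - u k))\<^sup>2 = 2 * J (u n) + 2 * J (u k) - 4 * J ((1/2) *\<^sub>R (u n + u k))"
      using norm_sq_diff[of "u n" "u k"] norm_sq_add[of "u n" "u k"]
      by (simp add: J_def scaleR add field_simps del: scaleR_add_right)
    then show ?thesis
      using m_le[of "(1/2) *\<^sub>R (u n + u k)"] u[of n] u[of k] by simp
  qed
  have "Cauchy u"
  proof (rule metric_CauchyI)
    fix e :: real assume "e > 0"
    then obtain N where N: "1 / real (Suc N) < e\<^sup>2 / 4"
      using nat_approx_posE[of "e\<^sup>2 / 4"] by auto
    have "dist (u n) (u k) < e" if "n \<ge> N" "k \<ge> N" for n k
    proof -
      have "1 / real (Suc n) \<le> 1 / real (Suc N)" "1 / real (Suc k) \<le> 1 / real (Suc N)"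
        using that by (auto intro!: divide_left_mono)
      then have "(norm (u n - u k))\<^sup>2 < e\<^sup>2"
        using close[of n k] N by simp
      then show ?thesis
        using \<open>e > 0\<close> by (simp add: dist_norm power_less_imp_less_base)
    qed
    then show "\<exists>N. \<forall>n\<ge>N. \<forall>k\<ge>N. dist (u n) (u k) < e" by blast
  qed
  then obtain y where y: "u \<longlonglongrightarrow> y"
    using Cauchy_convergent convergentD by blast
  have "(\<lambda>n. J (u n)) \<longlonglongrightarrow> J y"
    unfolding J_def by (intro tendsto_intros y bounded_linear.tendsto[OF lin])
  moreover have "(\<lambda>n. m + 1 / real (Suc n)) \<longlonglongrightarrow> m + 0"
    by (intro tendsto_intros LIMSEQ_Suc[OF lim_1_over_n])
  ultimately have "J y \<le> m"
    using u by (intro LIMSEQ_le[of _ "J y" _ m]) (auto intro!: exI[of _ 0] less_imp_le)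
  then have J_min: "J y \<le> J x" for x
    using m_le[of x] by simp
  have Re_eq: "Re (\<phi> x) = Re (cinner x y)" for x
  proof -
    define d where "d = Re (cinner x y) - Re (\<phi> x)"
    have q: "0 \<le> 2 * t * d + t\<^sup>2 * (norm x)\<^sup>2" for t
      using J_min[of "y + t *\<^sub>R x"] cinner_commute[of x y]
      by (simp add: J_def norm_sq_add add scaleR d_def cinner_scaleR_right power_mult_distrib
          algebra_simps)
    have "d = 0"
    proof (cases "x = 0")
      case True
      then show ?thesis using scale[of 0 0] by (simp add: d_def)
    next
      case False
      then show ?thesis
        using q[of "- d / (norm x)\<^sup>2"] by (auto simp: field_simps power2_eq_square mult_le_0_iff)
    qed
    then show ?thesis by (simp add: d_def)
  qed
  have "\<phi> x = cinner x y" for x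
    using Re_eq[of x] Re_eq[of "\<i> *\<^sub>C x"]
    by (simp add: scale cinner_scaleC_left complex_eq_iff)
  then show ?thesis by blast
qed

lemma bounded_clinear_intro:
  fixes A :: "'a::chilbert_space \<Rightarrow> 'a"
  assumes "\<And>x y. A (x + y) = A x + A y" and "\<And>c x. A (c *\<^sub>C x) = c *\<^sub>C A x"
    and "\<And>x. norm (A x) \<le> norm x * K"
  shows "bounded_clinear A"
  unfolding bounded_clinear_def
  using assms by (auto intro!: bounded_linear_intro[where K = K] simp: scaleR_scaleC)

lemma bounded_clinear_imp:
  fixes A :: "'a::chilbert_space \<Rightarrow> 'a"
  assumes "bounded_clinear A"
  shows bounded_clinear_bounded_linear: "bounded_linear A"
    and bounded_clinear_add: "A (x + y) = A x + A y"
    and bounded_clinear_diff: "A (x - y) = A x - A y"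
    and bounded_clinear_scale: "A (c *\<^sub>C x) = c *\<^sub>C A x"
    and bounded_clinear_zero: "A 0 = 0"
  using assms by (auto simp: bounded_clinear_def bounded_linear.linear linear_add linear_diff
      linear_0)

lemma sesquilinear_representation:
  fixes f :: "'a::chilbert_space \<Rightarrow> 'a \<Rightarrow> complex"
  assumes add_left: "\<And>x y z. f (x + y) z = f x z + f y z"
    and scale_left: "\<And>c x y. f (c *\<^sub>C x) y = c * f x y"
    and add_right: "\<And>x y z. f x (y + z) = f x y + f x z"
    and scale_right: "\<And>c x y. f x (c *\<^sub>C y) = cnj c * f x y"
    and bound: "\<And>x y. cmod (f x y) \<le> K * norm x * norm y"
  obtains A where "bounded_clinear A" and "\<And>x y. f x y = cinner x (A y)"
proof -
  have "\<exists>z. \<forall>x. f x y = cinner x z" for y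
    by (rule Riesz_representation[where K = "K * norm y"])
      (use bound[of _ y] in \<open>simp_all add: add_left scale_left mult_ac\<close>)
  then obtain A where A: "\<And>x y. f x y = cinner x (A y)"
    by metis
  have "bounded_clinear A"
  proof (rule bounded_clinear_intro[where K = K])
    show "A (x + y) = A x + A y" for x y
      by (rule cinner_eqI) (simp add: cinner.expand add_right flip: A)
    show "A (c *\<^sub>C x) = c *\<^sub>C A x" for c x
      by (rule cinner_eqI) (simp add: cinner.expand scale_right flip: A)
    show "norm (A x) \<le> norm x * K" for x
    proof (cases "A x = 0")
      case True
      then show ?thesis
        using bound[of x x] order_trans[OF norm_ge_zero bound[of x x]]
        by (cases "x = 0") (auto simp: zero_le_mult_iff)
    next
      case False
      have "norm (A x) * norm (A x) \<le> (norm x * K) * norm (A x)"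
        using bound[of "A x" x] by (simp add: A cinner_norm power2_eq_square mult_ac norm_mult)
      then show ?thesis using False by simp
    qed
  qed
  with A that show thesis by blast
qed

lemma cinner_adj:
  fixes T :: "'a::chilbert_space \<Rightarrow> 'a"
  assumes T: "bounded_clinear T"
  shows "cinner (T x) y = cinner x (adj T y)"
proof -
  interpret bounded_linear T using T by (rule bounded_clinear_bounded_linear)
  obtain K where K: "\<And>x. norm (T x) \<le> norm x * K" using bounded by blast
  have "\<exists>z. \<forall>x. cinner (T x) y = cinner x z"
  proof (rule Riesz_representation[where K = "K * norm y"])
    show "cmod (cinner (T x) y) \<le> K * norm y * norm x" for x
      using norm_cinner_le[of "T x" y] mult_right_mono[OF K[of x] norm_ge_zero[of y]]
      by (simp add: mult_ac)
  qed (simp_all add: bounded_clinear_imp[OF T] cinner.expand)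
  then have "\<exists>!z. \<forall>x. cinner (T x) y = cinner x z"
    by (metis cinner_eqI)
  moreover have "adj T y = (THE z. \<forall>x. cinner (T x) y = cinner x z)"
    by (simp add: hadjoint_def hspace_of_def)
  ultimately show ?thesis
    using theI'[of "\<lambda>z. \<forall>x. cinner (T x) y = cinner x z"] by metis
qed

section \<open>Square roots\<close>

text \<open>The scalar sequence converges to the solution \<open>1\<close> of \<open>y = (1 + y\<^sup>2) / 2\<close>; it dominates the
  operator iteration below.\<close>

fun sqrt_iter_bound :: "nat \<Rightarrow> real" where
  "sqrt_iter_bound 0 = 0"
| "sqrt_iter_bound (Suc n) = (1 + (sqrt_iter_bound n)\<^sup>2) / 2"

fun sqrt_iter :: "('a::real_normed_vector \<Rightarrow>\<^sub>L 'a) \<Rightarrow> nat \<Rightarrow> 'a \<Rightarrow>\<^sub>L 'a" where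
  "sqrt_iter B 0 = 0"
| "sqrt_iter B (Suc n) = (1/2) *\<^sub>R (B + (sqrt_iter B n o\<^sub>L sqrt_iter B n))"

lemma sqrt_iter_bound_range: "0 \<le> sqrt_iter_bound n \<and> sqrt_iter_bound n \<le> 1"
  by (induction n) (auto simp: power_le_one)

lemma sqrt_iter_bound_mono: "sqrt_iter_bound n \<le> sqrt_iter_bound (Suc n)"
  using zero_le_power2[of "sqrt_iter_bound n - 1"] by (simp add: power2_diff)

lemma norm_sqrt_iter: 
  assumes "norm B \<le> 1" shows "norm (sqrt_iter B n) \<le> sqrt_iter_bound n"
proof (induction n)
  case (Suc n)
  have "norm (sqrt_iter B n o\<^sub>L sqrt_iter B n) \<le> norm (sqrt_iter B n) * norm (sqrt_iter B n)"
    by (rule norm_blinfun_compose)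
  also have "\<dots> \<le> (sqrt_iter_bound n)\<^sup>2"
    unfolding power2_eq_square by (intro mult_mono Suc) (use sqrt_iter_bound_range in auto)
  finally show ?case
    using norm_triangle_ineq[of B "sqrt_iter B n o\<^sub>L sqrt_iter B n"] assms by simp
qed simp

text \<open>The identity \<open>X\<^sup>2 - Y\<^sup>2 = X (X - Y) + (X - Y) Y\<close> holds without commutativity, so the steps of
  the operator iteration are bounded by those of the scalar one.\<close>

lemma norm_sqrt_iter_step:
  assumes "norm B \<le> 1"
  shows "norm (sqrt_iter B (Suc n) - sqrt_iter B n) \<le> sqrt_iter_bound (Suc n) - sqrt_iter_bound n"
proof (induction n)
  case 0
  then show ?case using assms by simp
next
  case (Suc n)
  interpret c: bounded_bilinear "(o\<^sub>L) :: ('a \<Rightarrow>\<^sub>L 'a) \<Rightarrow> ('a \<Rightarrow>\<^sub>L 'a) \<Rightarrow> _"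
    by (rule bounded_bilinear_blinfun_compose)
  let ?X = "sqrt_iter B (Suc n)" and ?Y = "sqrt_iter B n"
  let ?x = "sqrt_iter_bound (Suc n)" and ?y = "sqrt_iter_bound n"
  have "sqrt_iter B (Suc (Suc n)) - ?X = (1/2) *\<^sub>R ((?X o\<^sub>L ?X) - (?Y o\<^sub>L ?Y))"
    by (subst (1 2) sqrt_iter.simps(2)) (simp add: algebra_simps del: sqrt_iter.simps)
  also have "\<dots> = (1/2) *\<^sub>R ((?X o\<^sub>L (?X - ?Y)) + ((?X - ?Y) o\<^sub>L ?Y))"
    by (simp add: c.diff_left c.diff_right del: sqrt_iter.simps)
  also have "norm \<dots> \<le> 1/2 * (?x * (?x - ?y) + (?x - ?y) * ?y)"
  proof -
    have "norm (?X o\<^sub>L (?X - ?Y)) \<le> ?x * (?x - ?y)"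
      using Suc norm_sqrt_iter[OF assms, of "Suc n"] sqrt_iter_bound_range[of "Suc n"]
      by (intro order_trans[OF norm_blinfun_compose] mult_mono) (auto simp del: sqrt_iter.simps sqrt_iter_bound.simps)
    moreover have "norm ((?X - ?Y) o\<^sub>L ?Y) \<le> (?x - ?y) * ?y"
      using Suc norm_sqrt_iter[OF assms, of n] sqrt_iter_bound_mono[of n]
      by (intro order_trans[OF norm_blinfun_compose] mult_mono) (auto simp del: sqrt_iter.simps sqrt_iter_bound.simps)
    ultimately show ?thesis
      using norm_triangle_ineq[of "?X o\<^sub>L (?X - ?Y)" "(?X - ?Y) o\<^sub>L ?Y"] by simp
  qed
  also have "\<dots> = sqrt_iter_bound (Suc (Suc n)) - ?x"
  proof -
    have "sqrt_iter_bound (Suc (Suc n)) - ?x = (1 + ?x\<^sup>2) / 2 - (1 + ?y\<^sup>2) / 2"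
      by (simp only: sqrt_iter_bound.simps)
    then show ?thesis
      by (simp add: field_simps power2_eq_square del: sqrt_iter_bound.simps)
  qed
  finally show ?case .
qed

lemma sqrt_iter_convergent:
  fixes B :: "'a::banach \<Rightarrow>\<^sub>L 'a"
  assumes B: "norm B \<le> 1"
  shows "convergent (sqrt_iter B)"
proof -
  have mono: "mono sqrt_iter_bound"
    using sqrt_iter_bound_mono by (rule incseq_SucI)
  have "convergent sqrt_iter_bound"
  proof (rule Bseq_mono_convergent)
    show "Bseq sqrt_iter_bound"
      by (rule BseqI'[of _ 1]) (use sqrt_iter_bound_range in auto)
  qed (use mono in \<open>auto simp: mono_def\<close>)
  then have C: "Cauchy sqrt_iter_bound" by (rule convergent_Cauchy)
  have step: "norm (sqrt_iter B (n + k) - sqrt_iter B n) \<le> sqrt_iter_bound (n + k) - sqrt_iter_bound n" for n k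
  proof (induction k)
    case (Suc k)
    then show ?case
      using norm_sqrt_iter_step[OF B, of "n + k"]
        norm_triangle_ineq[of "sqrt_iter B (Suc (n + k)) - sqrt_iter B (n + k)" "sqrt_iter B (n + k) - sqrt_iter B n"]
      by (simp del: sqrt_iter.simps sqrt_iter_bound.simps)
  qed simp
  have dist: "dist (sqrt_iter B m) (sqrt_iter B n) \<le> dist (sqrt_iter_bound m) (sqrt_iter_bound n)" for m n
  proof (cases "n \<le> m")
    case True
    then show ?thesis using step[of n "m - n"] by (simp add: dist_norm)
  next
    case False
    then show ?thesis using step[of m "n - m"] by (simp add: dist_norm norm_minus_commute)
  qed
  have "Cauchy (sqrt_iter B)"
    using C dist unfolding Cauchy_def by (meson le_less_trans)
  then show ?thesis by (rule Cauchy_convergent)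
qed

text \<open>As \<open>0 \<le> f x x \<le> \<parallel>x\<parallel>\<^sup>2\<close>, the form is represented by an operator \<open>I - B\<close> with
  \<open>\<parallel>B\<parallel> \<le> 1\<close>; the limit \<open>Y\<close> of the iteration solves \<open>Y = (B + Y\<^sup>2) / 2\<close>, so that
  \<open>(I - Y)\<^sup>2 = I - B\<close>, and \<open>Y\<close> inherits symmetry from \<open>B\<close>.\<close>

lemma contractive_psd_form_factorization:
  fixes f :: "'a::chilbert_space \<Rightarrow> 'a \<Rightarrow> complex"
  assumes psd: "psd_form UNIV f"
    and le: "\<And>x. Re (f x x) \<le> (norm x)\<^sup>2"
  obtains C where "bounded_clinear C" and "\<And>x y. f x y = cinner (C x) (C y)"
proof -
  interpret f: psd_form UNIV f by fact
  define g where "g x y = cinner x y - f x y" for x y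
  interpret g: psd_form UNIV g
    by standard (use le in \<open>auto simp: g_def cinner.expand f.expand algebra_simps
      norm_sq_cinner simp flip: cinner_commute f.herm\<close>)
  have g_le: "Re (g x x) \<le> (norm x)\<^sup>2" for x
    using f.nonneg[of x] by (simp add: g_def norm_sq_cinner)
  have g_bound: "cmod (g x y) \<le> 1 * norm x * norm y" for x y
  proof (rule power2_le_imp_le)
    have "(cmod (g x y))\<^sup>2 \<le> Re (g x x) * Re (g y y)"
      using g.Cauchy_Schwarz by simp
    also have "\<dots> \<le> (norm x)\<^sup>2 * (norm y)\<^sup>2"
      by (intro mult_mono g_le) (use g.nonneg in auto)
    finally show "(cmod (g x y))\<^sup>2 \<le> (1 * norm x * norm y)\<^sup>2"
      by (simp add: power_mult_distrib)
  qed simp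
  obtain A where A: "bounded_clinear A" "\<And>x y. g x y = cinner x (A y)"
    by (rule sesquilinear_representation[of g 1]) (use g_bound in \<open>auto simp: g.expand\<close>)
  define B where "B = Blinfun A"
  have B_apply: "blinfun_apply B = A"
    unfolding B_def using A(1) by (simp add: bounded_clinear_def bounded_linear_Blinfun_apply)
  have A_sym: "cinner (A x) y = cinner x (A y)" for x y
    using g.herm[of x y] A(2) by (metis UNIV_I cinner_commute)
  have normB: "norm B \<le> 1"
  proof (rule norm_blinfun_bound)
    show "norm (blinfun_apply B x) \<le> 1 * norm x" for x
    proof (cases "A x = 0")
      case False
      have "norm (A x) * norm (A x) \<le> norm x * norm (A x)"
        using g_bound[of "A x" x] by (simp add: A(2) cinner_norm power2_eq_square mult_ac norm_mult)
      then show ?thesis using False by (simp add: B_apply)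
    qed (simp add: B_apply)
  qed simp
  have iter: "(\<forall>x y. cinner (sqrt_iter B n x) y = cinner x (sqrt_iter B n y)) \<and>
      (\<forall>c x. sqrt_iter B n (c *\<^sub>C x) = c *\<^sub>C sqrt_iter B n x)" for n
  proof (induction n)
    case (Suc n)
    then show ?case
      by (auto simp: blinfun.add_left blinfun.scaleR_left B_apply A_sym bounded_clinear_imp[OF A(1)]
          cinner.expand cinner_scaleR_left cinner_scaleR_right scaleC_scaleR_commute scaleC_add_right)
  qed simp
  obtain Y where Y: "sqrt_iter B \<longlonglongrightarrow> Y"
    using sqrt_iter_convergent[OF normB] convergentD by blast
  have Yx: "(\<lambda>n. sqrt_iter B n x) \<longlonglongrightarrow> Y x" for x
    by (intro tendsto_intros Y)
  have Y_sym: "cinner (Y x) y = cinner x (Y y)" for x y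
  proof (rule LIMSEQ_unique)
    show "(\<lambda>n. cinner (sqrt_iter B n x) y) \<longlonglongrightarrow> cinner (Y x) y"
      by (intro tendsto_intros Yx)
    have "(\<lambda>n. cinner x (sqrt_iter B n y)) \<longlonglongrightarrow> cinner x (Y y)"
      by (intro tendsto_intros Yx)
    then show "(\<lambda>n. cinner (sqrt_iter B n x) y) \<longlonglongrightarrow> cinner x (Y y)"
      using iter by simp
  qed
  have Y_scale: "Y (c *\<^sub>C x) = c *\<^sub>C Y x" for c x
  proof (rule LIMSEQ_unique)
    show "(\<lambda>n. sqrt_iter B n (c *\<^sub>C x)) \<longlonglongrightarrow> Y (c *\<^sub>C x)" by (rule Yx)
    have "(\<lambda>n. c *\<^sub>C sqrt_iter B n x) \<longlonglongrightarrow> c *\<^sub>C Y x"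
      by (intro tendsto_intros Yx)
    then show "(\<lambda>n. sqrt_iter B n (c *\<^sub>C x)) \<longlonglongrightarrow> c *\<^sub>C Y x"
      using iter by simp
  qed
  have Y_eq: "Y = (1/2) *\<^sub>R (B + (Y o\<^sub>L Y))"
  proof (rule LIMSEQ_unique)
    show "(\<lambda>n. sqrt_iter B (Suc n)) \<longlonglongrightarrow> Y"
      using Y by (rule LIMSEQ_Suc)
    show "(\<lambda>n. sqrt_iter B (Suc n)) \<longlonglongrightarrow> (1/2) *\<^sub>R (B + (Y o\<^sub>L Y))"
      by (simp, intro tendsto_intros Y bounded_bilinear.tendsto[OF bounded_bilinear_blinfun_compose])
  qed
  have YY: "Y (Y x) = 2 *\<^sub>R Y x - A x" for x
  proof -
    have "2 *\<^sub>R Y x = 2 *\<^sub>R ((1/2) *\<^sub>R (B + (Y o\<^sub>L Y))) x"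
      using Y_eq by simp
    then show ?thesis by (simp add: blinfun.add_left blinfun.scaleR_left B_apply)
  qed
  define C where "C x = x - Y x" for x
  have "bounded_clinear C"
    unfolding bounded_clinear_def C_def
    by (auto intro!: bounded_linear_intros simp: Y_scale scaleC_diff_right)
  moreover have "f x y = cinner (C x) (C y)" for x y
  proof -
    have "cinner (C x) (C y) = cinner x y - 2 * cinner x (Y y) + cinner x (Y (Y y))"
      by (simp add: C_def cinner.expand Y_sym)
    also have "\<dots> = cinner x y - g x y"
      by (simp add: YY cinner.expand cinner_scaleR_right A(2))
    finally show ?thesis by (simp add: g_def)
  qed
  ultimately show thesis using that by blast
qed

lemma bounded_psd_form_factorization:
  fixes f :: "'a::chilbert_space \<Rightarrow> 'a \<Rightarrow> complex"
  assumes psd: "psd_form UNIV f"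
    and le: "\<And>x. Re (f x x) \<le> K * (norm x)\<^sup>2"
  obtains C where "bounded_clinear C" and "\<And>x y. f x y = cinner (C x) (C y)"
proof -
  interpret f: psd_form UNIV f by fact
  define k where "k = max K 1"
  have k: "k > 0" by (simp add: k_def)
  have le': "Re (f x x) \<le> k * (norm x)\<^sup>2" for x
    using le[of x] mult_right_mono[of K k "(norm x)\<^sup>2"] by (simp add: k_def)
  obtain C where C: "bounded_clinear C" "\<And>x y. f x y / of_real k = cinner (C x) (C y)"
  proof (rule contractive_psd_form_factorization[of "\<lambda>x y. f x y / of_real k"])
    show "psd_form UNIV (\<lambda>x y. f x y / complex_of_real k)"
      by standard (use k f.nonneg in \<open>auto simp: f.expand add_divide_distrib simp flip: f.herm\<close>)
    show "Re (f x x / complex_of_real k) \<le> (norm x)\<^sup>2" for x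
      using le'[of x] k by (simp add: field_simps)
  qed blast
  define D where "D x = sqrt k *\<^sub>R C x" for x
  have "bounded_clinear D"
    using C(1) unfolding bounded_clinear_def D_def
    by (auto intro!: bounded_linear_intros simp: scaleC_scaleR_commute bounded_linear_const_scaleR)
  moreover have "f x y = cinner (D x) (D y)" for x y
  proof -
    have "complex_of_real (sqrt k) * complex_of_real (sqrt k) = complex_of_real k"
      using k by (simp flip: of_real_mult)
    then show ?thesis
      using C(2)[of x y] k
      by (simp add: D_def cinner_scaleR_left cinner_scaleR_right field_simps flip: mult.assoc)
  qed
  ultimately show thesis using that by blast
qed

section \<open>The asymptotic limit of a contraction\<close>

lemma funpow_clinear:
  fixes S :: "'a::chilbert_space \<Rightarrow> 'a"
  assumes "bounded_clinear S"
  shows funpow_add_clinear: "(S ^^ n) (x + y) = (S ^^ n) x + (S ^^ n) y"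
    and funpow_scale_clinear: "(S ^^ n) (c *\<^sub>C x) = c *\<^sub>C (S ^^ n) x"
    and funpow_diff_clinear: "(S ^^ n) (x - y) = (S ^^ n) x - (S ^^ n) y"
  by (induction n) (simp_all add: bounded_clinear_imp[OF assms])

text \<open>The forms \<open>\<langle>S\<^sup>n x, S\<^sup>n y\<rangle>\<close> converge because, by polarization, they are combinations of the
  decreasing sequences \<open>\<parallel>S\<^sup>n z\<parallel>\<^sup>2\<close>. The limit form is factored as \<open>\<langle>C x, C y\<rangle>\<close>.\<close>

lemma contraction_asymptotic_limit:
  fixes S :: "'a::chilbert_space \<Rightarrow> 'a"
  assumes S: "bounded_clinear S" and contr: "\<And>x. norm (S x) \<le> norm x"
  obtains C where "bounded_clinear C"
    and "\<And>x. (\<lambda>n. (norm ((S ^^ n) x))\<^sup>2) \<longlonglongrightarrow> (norm (C x))\<^sup>2"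
proof -
  have le: "norm ((S ^^ n) x) \<le> norm x" for n x
    by (induction n) (auto intro: order_trans[OF contr])
  have self: "convergent (\<lambda>n. cinner ((S ^^ n) x) ((S ^^ n) x))" for x
  proof -
    have "decseq (\<lambda>n. (norm ((S ^^ n) x))\<^sup>2)"
      by (rule decseq_SucI) (simp add: contr power_mono)
    then have "convergent (\<lambda>n. (norm ((S ^^ n) x))\<^sup>2)"
      by (rule decseq_convergent[of _ 0]) (auto simp: convergent_def)
    then show ?thesis
      unfolding cinner_norm by (auto simp: convergent_def simp del: of_real_power intro: tendsto_of_real)
  qed
  have conv: "convergent (\<lambda>n. cinner ((S ^^ n) x) ((S ^^ n) y))" for x y
  proof -
    have eq: "cinner ((S ^^ n) x) ((S ^^ n) y) = (1/4) *
      (cinner ((S ^^ n) (x + y)) ((S ^^ n) (x + y)) - cinner ((S ^^ n) (x - y)) ((S ^^ n) (x - y))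
      + \<i> * cinner ((S ^^ n) (x + \<i> *\<^sub>C y)) ((S ^^ n) (x + \<i> *\<^sub>C y))
      - \<i> * cinner ((S ^^ n) (x - \<i> *\<^sub>C y)) ((S ^^ n) (x - \<i> *\<^sub>C y)))" for n
      unfolding funpow_clinear[OF S] cinner.polarization[OF UNIV_I UNIV_I, symmetric] by simp
    show ?thesis
      unfolding eq
      by (intro convergent_mult convergent_add convergent_diff convergent_const self)
  qed
  define f where "f x y = lim (\<lambda>n. cinner ((S ^^ n) x) ((S ^^ n) y))" for x y
  have f: "(\<lambda>n. cinner ((S ^^ n) x) ((S ^^ n) y)) \<longlonglongrightarrow> f x y" for x y
    unfolding f_def using conv by (simp add: convergent_LIMSEQ_iff)
  have Re_f: "(\<lambda>n. (norm ((S ^^ n) x))\<^sup>2) \<longlonglongrightarrow> Re (f x x)" for x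
    using tendsto_Re[OF f[of x x]] by (simp add: norm_sq_cinner)
  obtain C where C: "bounded_clinear C" "\<And>x y. f x y = cinner (C x) (C y)"
  proof (rule contractive_psd_form_factorization[of f])
    show "psd_form UNIV f"
    proof
      show "f (x + y) z = f x z + f y z" for x y z
        using f[of "x + y" z] tendsto_add[OF f[of x z] f[of y z]]
        by (intro LIMSEQ_unique) (auto simp: funpow_clinear[OF S] cinner.expand)
      show "f (c *\<^sub>C x) y = c * f x y" for c x y
        using f[of "c *\<^sub>C x" y] tendsto_mult[OF tendsto_const f[of x y]]
        by (intro LIMSEQ_unique) (auto simp: funpow_clinear[OF S] cinner.expand)
      show "f x y = cnj (f y x)" for x y
        using f[of x y] tendsto_cnj[OF f[of y x]]
        by (intro LIMSEQ_unique) (auto simp flip: cinner_commute)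
      show "0 \<le> Re (f x x)" for x
        by (rule LIMSEQ_le_const[OF Re_f]) auto
    qed simp
    show "Re (f x x) \<le> (norm x)\<^sup>2" for x
      by (rule LIMSEQ_le_const2[OF Re_f]) (use le in \<open>auto intro!: power_mono\<close>)
  qed blast
  with Re_f that show thesis
    by (simp add: cinner_norm)
qed

text \<open>If \<open>\<parallel>C J x\<parallel> = \<parallel>C x\<parallel>\<close>, then \<open>C x \<mapsto> C J x\<close> is well defined and isometric, hence extends by
  continuity to the closure of the range of \<open>C\<close>.\<close>

lemma isometry_on_range_closure:
  fixes C J :: "'a::chilbert_space \<Rightarrow> 'a"
  assumes C: "bounded_clinear C" and J: "bounded_clinear J"
    and iso: "\<And>x. norm (C (J x)) = norm (C x)"
  obtains g where "\<And>x u. (\<lambda>n. C (u n)) \<longlonglongrightarrow> x \<Longrightarrow> (\<lambda>n. C (J (u n))) \<longlonglongrightarrow> g x"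
proof -
  have iso_diff: "norm (C (J x) - C (J y)) = norm (C x - C y)" for x y
    using iso[of "x - y"] by (simp add: bounded_clinear_imp[OF C] bounded_clinear_imp[OF J])
  have "\<exists>y. \<forall>u. (\<lambda>n. C (u n)) \<longlonglongrightarrow> x \<longrightarrow> (\<lambda>n. C (J (u n))) \<longlonglongrightarrow> y" for x
  proof (cases "\<exists>u. (\<lambda>n. C (u n)) \<longlonglongrightarrow> x")
    case True
    then obtain u where u: "(\<lambda>n. C (u n)) \<longlonglongrightarrow> x" by blast
    then have "Cauchy (\<lambda>n. C (u n))" by (rule LIMSEQ_imp_Cauchy)
    then have "Cauchy (\<lambda>n. C (J (u n)))"
      by (simp add: Cauchy_def dist_norm iso_diff)
    then obtain y where y: "(\<lambda>n. C (J (u n))) \<longlonglongrightarrow> y"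
      using Cauchy_convergent convergentD by blast
    have "(\<lambda>n. C (J (v n))) \<longlonglongrightarrow> y" if v: "(\<lambda>n. C (v n)) \<longlonglongrightarrow> x" for v
    proof -
      have "(\<lambda>n. norm (C (v n) - C (u n))) \<longlonglongrightarrow> norm (x - x)"
        by (intro tendsto_intros u v)
      then have "(\<lambda>n. C (J (v n)) - C (J (u n))) \<longlonglongrightarrow> 0"
        by (simp add: tendsto_norm_zero_iff[of "\<lambda>n. C (J (v n)) - C (J (u n))", symmetric] iso_diff)
      from tendsto_add[OF this y] show ?thesis by simp
    qed
    then show ?thesis by blast
  qed blast
  then obtain g where "\<forall>x u. (\<lambda>n. C (u n)) \<longlonglongrightarrow> x \<longrightarrow> (\<lambda>n. C (J (u n))) \<longlonglongrightarrow> g x"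
    by metis
  with that show thesis by blast
qed

lemma hilbert_subset_range_closure:
  fixes C :: "'a::chilbert_space \<Rightarrow> 'a"
  assumes C: "bounded_clinear C"
  shows "hilbert_subset (closure (range C))"
  unfolding hilbert_subset_def csubspace_def
proof (intro conjI ballI allI)
  show "0 \<in> closure (range C)"
    using closure_subset[of "range C"] bounded_clinear_zero[OF C] by (metis rangeI subsetD)
  show "x + y \<in> closure (range C)" if xy: "x \<in> closure (range C)" "y \<in> closure (range C)" for x y
  proof -
    obtain u v where uv: "\<forall>n. u n \<in> range C" "u \<longlonglongrightarrow> x" "\<forall>n. v n \<in> range C" "v \<longlonglongrightarrow> y"
      using xy unfolding closure_sequential by blast
    have "u n + v n \<in> range C" for n
      using uv bounded_clinear_add[OF C] by (metis (mono_tags) image_iff rangeI)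
    then show ?thesis
      unfolding closure_sequential using tendsto_add[OF uv(2,4)] by (auto intro!: exI[of _ "\<lambda>n. u n + v n"])
  qed
  show "c *\<^sub>C x \<in> closure (range C)" if x: "x \<in> closure (range C)" for c x
  proof -
    obtain u where u: "\<forall>n. u n \<in> range C" "u \<longlonglongrightarrow> x"
      using x unfolding closure_sequential by blast
    have "c *\<^sub>C u n \<in> range C" for n
      using u bounded_clinear_scale[OF C] by (metis (mono_tags) image_iff rangeI)
    then show ?thesis
      unfolding closure_sequential using tendsto_scaleC[OF tendsto_const u(2)]
      by (auto intro!: exI[of _ "\<lambda>n. c *\<^sub>C u n"])
  qed
qed simp

lemma unitary_on_range_closure:
  fixes C J J' :: "'a::chilbert_space \<Rightarrow> 'a"
  assumes C: "bounded_clinear C" and J: "bounded_clinear J" and J': "bounded_clinear J'"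
    and inv: "\<And>x. J (J' x) = x" "\<And>x. J' (J x) = x"
    and iso: "\<And>x. norm (C (J x)) = norm (C x)"
  obtains U where
    "unitary_map (hspace_of (closure (range C))) (hspace_of (closure (range C))) U"
    and "\<And>x. U (C x) = C (J x)"
proof -
  let ?K = "closure (range C)"
  have iso': "norm (C (J' x)) = norm (C x)" for x
    using iso[of "J' x"] by (simp add: inv)
  obtain g where g: "\<And>x u. (\<lambda>n. C (u n)) \<longlonglongrightarrow> x \<Longrightarrow> (\<lambda>n. C (J (u n))) \<longlonglongrightarrow> g x"
    using isometry_on_range_closure[OF C J iso] by blast
  obtain g' where g': "\<And>x u. (\<lambda>n. C (u n)) \<longlonglongrightarrow> x \<Longrightarrow> (\<lambda>n. C (J' (u n))) \<longlonglongrightarrow> g' x"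
    using isometry_on_range_closure[OF C J' iso'] by blast
  have seq: "\<exists>u. (\<lambda>n. C (u n)) \<longlonglongrightarrow> x" if "x \<in> ?K" for x
  proof -
    obtain v where v: "\<forall>n. v n \<in> range C" "v \<longlonglongrightarrow> x"
      using \<open>x \<in> ?K\<close> unfolding closure_sequential by blast
    from v(1) have "\<forall>n. \<exists>y. v n = C y" by blast
    then obtain u where "v = (\<lambda>n. C (u n))" by metis
    with v(2) show ?thesis by blast
  qed
  have in_K: "x \<in> ?K" if "(\<lambda>n. C (u n)) \<longlonglongrightarrow> x" for u x
    using that unfolding closure_sequential by (auto intro!: exI[of _ "\<lambda>n. C (u n)"])
  have "bij_betw g ?K ?K"
  proof (rule bij_betw_byWitness[where f' = g'])
    show "\<forall>x\<in>?K. g' (g x) = x"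
    proof
      fix x assume "x \<in> ?K"
      then obtain u where u: "(\<lambda>n. C (u n)) \<longlonglongrightarrow> x" using seq by blast
      show "g' (g x) = x"
        using g'[OF g[OF u]] u by (simp add: inv LIMSEQ_unique)
    qed
    show "\<forall>x\<in>?K. g (g' x) = x"
    proof
      fix x assume "x \<in> ?K"
      then obtain u where u: "(\<lambda>n. C (u n)) \<longlonglongrightarrow> x" using seq by blast
      show "g (g' x) = x"
        using g[OF g'[OF u]] u by (simp add: inv LIMSEQ_unique)
    qed
    show "g ` ?K \<subseteq> ?K" "g' ` ?K \<subseteq> ?K"
      using seq in_K[OF g] in_K[OF g'] by fast+
  qed
  moreover have "g (x + y) = g x + g y" if xy: "x \<in> ?K" "y \<in> ?K" for x y
  proof -
    obtain u v where u: "(\<lambda>n. C (u n)) \<longlonglongrightarrow> x" and v: "(\<lambda>n. C (v n)) \<longlonglongrightarrow> y"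
      using seq xy by blast
    have "(\<lambda>n. C (u n + v n)) \<longlonglongrightarrow> x + y"
      using tendsto_add[OF u v] by (simp add: bounded_clinear_imp[OF C])
    from g[OF this] show ?thesis
      by (rule LIMSEQ_unique) (use tendsto_add[OF g[OF u] g[OF v]] in
        \<open>simp add: bounded_clinear_imp[OF C] bounded_clinear_imp[OF J]\<close>)
  qed
  moreover have "g (c *\<^sub>C x) = c *\<^sub>C g x" if x: "x \<in> ?K" for c x
  proof -
    obtain u where u: "(\<lambda>n. C (u n)) \<longlonglongrightarrow> x"
      using seq x by blast
    have "(\<lambda>n. C (c *\<^sub>C u n)) \<longlonglongrightarrow> c *\<^sub>C x"
      using tendsto_scaleC[OF tendsto_const u] by (simp add: bounded_clinear_imp[OF C])
    from g[OF this] show ?thesis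
      by (rule LIMSEQ_unique) (use tendsto_scaleC[OF tendsto_const g[OF u]] in
        \<open>simp add: bounded_clinear_imp[OF C] bounded_clinear_imp[OF J]\<close>)
  qed
  moreover have "cinner (g x) (g y) = cinner x y" if xy: "x \<in> ?K" "y \<in> ?K" for x y
  proof -
    obtain u v where u: "(\<lambda>n. C (u n)) \<longlonglongrightarrow> x" and v: "(\<lambda>n. C (v n)) \<longlonglongrightarrow> y"
      using seq xy by blast
    have "4 * cinner (C (J a)) (C (J b)) = 4 * cinner (C a) (C b)" for a b
      using iso[of "a + b"] iso[of "a - b"] iso[of "a + \<i> *\<^sub>C b"] iso[of "a - \<i> *\<^sub>C b"]
      unfolding cinner.polarization[of "C a" "C b", simplified]
        cinner.polarization[of "C (J a)" "C (J b)", simplified]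
      by (simp add: cinner_norm bounded_clinear_imp[OF C] bounded_clinear_imp[OF J])
    then have "cinner (C (J a)) (C (J b)) = cinner (C a) (C b)" for a b by simp
    then show ?thesis
      using tendsto_cinner[OF u v] tendsto_cinner[OF g[OF u] g[OF v]] LIMSEQ_unique by auto
  qed
  ultimately have "unitary_map (hspace_of ?K) (hspace_of ?K) g"
    by (simp add: unitary_map_def hspace_of_def)
  moreover have "g (C x) = C (J x)" for x
    using g[of "\<lambda>_. x" "C x"] by (simp add: LIMSEQ_const_iff)
  ultimately show thesis using that by blast
qed

section \<open>Compressions and restrictions of adjoints\<close>

text \<open>The subspaces \<open>L\<close> to which compressions are taken are isometric images of a complete space.
  Projections onto them and their closedness come from that space, so an inner product space is
  enough as ambient space.\<close>

locale pre_hilbert =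
  fixes H :: "'a::complex_vector hspace"
  assumes psd: "psd_form (hcarrier H) (hinner H)"
    and definite: "x \<in> hcarrier H \<Longrightarrow> hinner H x x = 0 \<Longrightarrow> x = 0"
begin

sublocale psd_form "hcarrier H" "hinner H"
  by (rule psd)

lemma eqI:
  assumes "x \<in> hcarrier H" "y \<in> hcarrier H" "\<And>z. z \<in> hcarrier H \<Longrightarrow> hinner H z x = hinner H z y"
  shows "x = y"
  using definite[of "x - y"] assms by (simp add: expand)

lemma hadjoint_eq:
  assumes "z \<in> hcarrier H" and "\<And>x. x \<in> hcarrier H \<Longrightarrow> hinner H (X x) y = hinner H x z"
  shows "hadjoint H X y = z"
  unfolding hadjoint_def using assms by (intro the_equality) (auto intro!: eqI)

lemma orth_proj_eq:
  assumes "csubspace L" "L \<subseteq> hcarrier H" "x \<in> hcarrier H"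
    and "y \<in> L" and orth: "\<And>z. z \<in> L \<Longrightarrow> hinner H (x - y) z = 0"
  shows "orth_proj H L x = y"
  unfolding orth_proj_def
proof (rule the_equality)
  fix y' assume y': "y' \<in> L \<and> (\<forall>z\<in>L. hinner H (x - y') z = 0)"
  have "y' - y \<in> L" using assms y' by (auto intro: csubspace_diff)
  then have "hinner H (x - y) (y' - y) = 0" "hinner H (x - y') (y' - y) = 0"
    using orth y' by auto
  moreover have "y \<in> hcarrier H" "y' \<in> hcarrier H"
    using assms y' by auto
  ultimately have "hinner H ((x - y) - (x - y')) (y' - y) = 0"
    using assms(3) by (subst diff_left) (simp_all add: closed_ops)
  then have "hinner H (y' - y) (y' - y) = 0" by simp
  then have "y' - y = 0"
    using \<open>y \<in> hcarrier H\<close> \<open>y' \<in> hcarrier H\<close> by (intro definite) (simp_all add: expand)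
  then show "y' = y" by simp
qed (use assms in auto)

end

lemma pre_hilbert_hspace_of:
  "csubspace V \<Longrightarrow> pre_hilbert (hspace_of V)"
  by standard (auto simp: hspace_of_def cinner.expand cinner.nonneg simp flip: cinner_commute)

lemma pre_hilbert_direct_sum:
  assumes "pre_hilbert H" and "pre_hilbert K"
  shows "pre_hilbert (H \<oplus>\<^sub>H K)"
proof -
  interpret H: pre_hilbert H by fact
  interpret K: pre_hilbert K by fact
  have "csubspace (hcarrier (H \<oplus>\<^sub>H K))"
    by (auto simp: direct_sum_def csubspace_def scaleC_prod_def zero_prod_def H.expand K.expand)
  then have "psd_form (hcarrier (H \<oplus>\<^sub>H K)) (hinner (H \<oplus>\<^sub>H K))"
    by unfold_locales
      (auto simp: direct_sum_def scaleC_prod_def H.expand K.expand algebra_simps H.nonneg K.nonneg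
        simp flip: H.herm K.herm)
  moreover have "x = 0 \<and> y = 0"
    if "hinner H x x + hinner K y y = 0" "x \<in> hcarrier H" "y \<in> hcarrier K" for x y
  proof -
    have "Re (hinner H x x) = 0 \<and> Re (hinner K y y) = 0"
      using that H.nonneg[of x] K.nonneg[of y] by (simp add: complex_eq_iff)
    then show ?thesis
      using that by (auto simp: complex_eq_iff H.Im_self K.Im_self intro: H.definite K.definite)
  qed
  ultimately show ?thesis
    by (auto simp: pre_hilbert_def direct_sum_def zero_prod_def)
qed

context pre_hilbert
begin

text \<open>The orthogonal projection onto the range of an isometry \<open>V\<close> from a Hilbert space exists by
  the Riesz representation of \<open>\<langle>V x, h\<rangle>\<close> in the domain of \<open>V\<close>.\<close>

lemma orth_proj_range_isometry:
  fixes V :: "'c::chilbert_space \<Rightarrow> 'a"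
  assumes V: "\<And>x. V x \<in> hcarrier H" "\<And>x y. V (x + y) = V x + V y" "\<And>c x. V (c *\<^sub>C x) = c *\<^sub>C V x"
    and iso: "\<And>x y. hinner H (V x) (V y) = cinner x y"
    and h: "h \<in> hcarrier H"
  obtains y where "\<And>x. hinner H (V x) h = cinner x y" and "orth_proj H (range V) h = V y"
proof -
  have "\<exists>y. \<forall>x. hinner H (V x) h = cinner x y"
  proof (rule Riesz_representation[where K = "sqrt (Re (hinner H h h))"])
    show "cmod (hinner H (V x) h) \<le> sqrt (Re (hinner H h h)) * norm x" for x
    proof (rule power2_le_imp_le)
      show "(cmod (hinner H (V x) h))\<^sup>2 \<le> (sqrt (Re (hinner H h h)) * norm x)\<^sup>2"
        using Cauchy_Schwarz[of "V x" h] nonneg[OF h] V(1) h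
        by (simp add: iso cinner_norm power_mult_distrib mult.commute)
    qed (simp add: nonneg h)
  qed (use h V in \<open>simp_all add: expand\<close>)
  then obtain y where y: "\<And>x. hinner H (V x) h = cinner x y" by blast
  have "csubspace (range V)"
    using V(2,3) by (rule csubspace_range)
  then have "orth_proj H (range V) h = V y"
  proof (rule orth_proj_eq)
    fix z assume "z \<in> range V"
    then obtain x where "z = V x" by blast
    then show "hinner H (h - V y) z = 0"
      using y[of x] V(1) h herm[of h "V x"] by (simp add: expand iso flip: cinner_commute)
  qed (use V h in auto)
  with y that show thesis by blast
qed

text \<open>With \<open>L\<close> the range of \<open>V\<close>: \<open>L\<close> is invariant under the adjoint \<open>Y\<close> of \<open>X\<close> and \<open>V\<close> intertwines \<open>T\<close> with
  \<open>Y\<close> restricted to \<open>L\<close>; taking adjoints in \<open>L\<close> gives the compression of \<open>X\<close>.\<close>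

theorem compression_iff_intertwining_isometry:
  fixes T :: "'c::chilbert_space \<Rightarrow> 'c"
  assumes T: "bounded_clinear T"
    and X: "\<And>x. x \<in> hcarrier H \<Longrightarrow> X x \<in> hcarrier H"
    and Y: "\<And>x. x \<in> hcarrier H \<Longrightarrow> Y x \<in> hcarrier H"
    and adjoint: "\<And>x y. x \<in> hcarrier H \<Longrightarrow> y \<in> hcarrier H \<Longrightarrow> hinner H (X x) y = hinner H x (Y y)"
  shows "(\<exists>L. closed_subspace H L \<and> coinvariant H X L \<and>
      unitarily_equivalent (hspace_of UNIV) (adj T) (sub_hspace H L) (compression H L X)) \<longleftrightarrow>
    (\<exists>V. (\<forall>x. V x \<in> hcarrier H) \<and> (\<forall>x y. V (x + y) = V x + V y) \<and> (\<forall>c x. V (c *\<^sub>C x) = c *\<^sub>C V x) \<and>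
      (\<forall>x y. hinner H (V x) (V y) = cinner x y) \<and> (\<forall>x. V (T x) = Y (V x)))"
    (is "?lhs \<longleftrightarrow> ?rhs")
proof
  assume ?lhs
  then obtain L V where L: "L \<subseteq> hcarrier H" "csubspace L" and co: "hadjoint H X ` L \<subseteq> L"
    and bij: "bij_betw V UNIV L"
    and lin: "\<And>x y. V (x + y) = V x + V y" "\<And>c x. V (c *\<^sub>C x) = c *\<^sub>C V x"
    and iso: "\<And>x y. hinner H (V x) (V y) = cinner x y"
    and inter: "\<And>x. V (adj T x) = orth_proj H L (X (V x))"
    unfolding closed_subspace_def coinvariant_def unitarily_equivalent_def unitary_map_def
      compression_def
    by (auto simp: hspace_of_def[of UNIV] sub_hspace_def)
  have range: "range V = L" using bij by (simp add: bij_betw_def)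
  have mem: "V x \<in> hcarrier H" for x using range L by auto
  have "V (T x) = Y (V x)" for x
  proof -
    have "hadjoint H X (V x) = Y (V x)"
      by (rule hadjoint_eq) (use Y mem adjoint in auto)
    then have "Y (V x) \<in> L" using co range by (metis image_subset_iff rangeI)
    then obtain z where z: "Y (V x) = V z" using range by auto
    have "cinner y (T x) = cinner y z" for y
    proof -
      obtain w where w: "\<And>x. hinner H (V x) (X (V y)) = cinner x w"
        "orth_proj H (range V) (X (V y)) = V w"
        using orth_proj_range_isometry[of V "X (V y)"] mem lin iso X by metis
      have "V (adj T y) = V w" using inter[of y] w(2) range by simp
      then have "adj T y = w" using bij by (simp add: bij_betw_def inj_eq)
      then have "cinner x (adj T y) = hinner H (V x) (X (V y))" using w(1) by simp
      also have "\<dots> = cnj (hinner H (X (V y)) (V x))"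
        using mem X by (intro herm) auto
      also have "\<dots> = cnj (hinner H (V y) (V z))"
        using adjoint mem z by simp
      finally have "cnj (cinner (T x) y) = cinner y z"
        by (simp add: cinner_adj[OF T] iso)
      then show ?thesis by (simp flip: cinner_commute)
    qed
    then show ?thesis using z cinner_eqI by metis
  qed
  then show ?rhs using mem lin iso by blast
next
  assume ?rhs
  then obtain V where mem: "\<And>x. V x \<in> hcarrier H"
    and lin: "\<And>x y. V (x + y) = V x + V y" "\<And>c x. V (c *\<^sub>C x) = c *\<^sub>C V x"
    and iso: "\<And>x y. hinner H (V x) (V y) = cinner x y"
    and inter: "\<And>x. V (T x) = Y (V x)" by blast
  have V_diff: "V (x - y) = V x - V y" for x y
    using lin(1)[of "x - y" y] by (simp add: algebra_simps)
  have "inj V"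
  proof (rule injI)
    fix x y assume "V x = V y"
    then have "hinner H (V (x - y)) (V (x - y)) = 0"
      by (simp add: V_diff closed_ops)
    then show "x = y" by (simp add: iso)
  qed
  have hnorm_V: "hnorm H (V x) = norm x" for x
    by (simp add: hnorm_def iso cinner_norm)
  have "csubspace (range V)"
    using lin by (rule csubspace_range)
  moreover have "l \<in> range V"
    if u: "\<forall>n::nat. u n \<in> range V" and l: "l \<in> hcarrier H" and lim: "(\<lambda>n. hnorm H (u n - l)) \<longlonglongrightarrow> 0" for u l
  proof -
    have "\<forall>n. \<exists>y. u n = V y" using u by blast
    then obtain x where x: "\<And>n. u n = V (x n)" by metis
    have tri: "norm (x n - x m) \<le> hnorm H (u n - l) + hnorm H (u m - l)" for n m
    proof -
      have "V (x n - x m) = (u n - l) + - (u m - l)" by (simp add: V_diff x)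
      then have "norm (x n - x m) \<le> hnorm H (u n - l) + hnorm H (- (u m - l))"
        using hsqrt_triangle[of "u n - l" "- (u m - l)"] mem l x closed_ops
        by (simp add: hnorm_def flip: hnorm_V)
      also have "hnorm H (- (u m - l)) = hnorm H (u m - l)"
        using mem l x closed_ops unfolding hnorm_def by (simp add: minus_left minus_right del: minus_diff_eq)
      finally show ?thesis .
    qed
    have "Cauchy x"
    proof (rule metric_CauchyI)
      fix e :: real assume "e > 0"
      then obtain N where N: "\<And>n. n \<ge> N \<Longrightarrow> hnorm H (u n - l) < e / 2"
        using order_tendstoD(2)[OF lim, of "e / 2"] by (auto simp: eventually_sequentially)
      have "dist (x m) (x n) < e" if "m \<ge> N" "n \<ge> N" for m n
        using tri[of m n] N[OF that(1)] N[OF that(2)] by (simp add: dist_norm)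
      then show "\<exists>N. \<forall>m\<ge>N. \<forall>n\<ge>N. dist (x m) (x n) < e" by blast
    qed
    then obtain y where y: "x \<longlonglongrightarrow> y" using Cauchy_convergent convergentD by blast
    have "(\<lambda>n. norm (y - x n) + hnorm H (u n - l)) \<longlonglongrightarrow> norm (y - y) + 0"
      by (intro tendsto_intros lim y)
    moreover have "hnorm H (V y - l) \<le> norm (y - x n) + hnorm H (u n - l)" for n
      using hsqrt_triangle[of "V (y - x n)" "u n - l"] mem l x closed_ops
      by (simp add: hnorm_def V_diff flip: hnorm_V)
    ultimately have "hnorm H (V y - l) \<le> 0"
      by (intro LIMSEQ_le_const[of _ 0]) auto
    then have "hinner H (V y - l) (V y - l) = 0"
      using nonneg[of "V y - l"] Im_self[of "V y - l"] mem l closed_ops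
      by (simp add: hnorm_def complex_eq_iff)
    then have "V y - l = 0" using mem l by (intro definite) (auto simp: expand)
    then show ?thesis by (metis eq_iff_diff_eq_0 rangeI)
  qed
  ultimately have "closed_subspace H (range V)"
    unfolding closed_subspace_def using mem by blast
  moreover have "coinvariant H X (range V)"
  proof -
    have "hadjoint H X (V x) = V (T x)" for x
      unfolding inter by (rule hadjoint_eq) (use Y mem adjoint in auto)
    then show ?thesis by (auto simp: coinvariant_def)
  qed
  moreover have "V (adj T x) = orth_proj H (range V) (X (V x))" for x
  proof -
    obtain w where w: "\<And>y. hinner H (V y) (X (V x)) = cinner y w"
      "orth_proj H (range V) (X (V x)) = V w"
      using orth_proj_range_isometry[of V "X (V x)"] mem lin iso X by metis
    have "cinner y (adj T x) = cinner y w" for y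
    proof -
      have "cinner y w = cnj (hinner H (X (V x)) (V y))"
        unfolding w(1)[symmetric] using mem X by (intro herm) auto
      also have "\<dots> = cnj (hinner H (V x) (V (T y)))"
        using adjoint mem inter by simp
      also have "\<dots> = cinner (T y) x" by (simp add: iso flip: cinner_commute)
      finally show ?thesis by (simp add: cinner_adj[OF T])
    qed
    then show ?thesis using w(2) cinner_eqI by metis
  qed
  ultimately show ?lhs
    unfolding unitarily_equivalent_def unitary_map_def compression_def
    using \<open>inj V\<close> lin iso
    by (intro exI[of _ "range V"] conjI exI[of _ V])
      (auto simp: hspace_of_def[of UNIV] sub_hspace_def bij_betw_def)
qed

end

section \<open>Laurent series with vector coefficients\<close>

lemma bij_betw_neg_int: "bij_betw (\<lambda>n::nat. - int n - 1) UNIV {..<0}"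
  by (rule bij_betw_byWitness[where f' = "\<lambda>k. nat (- k - 1)"]) auto

lemma bij_betw_nonneg_int: "bij_betw int UNIV {0..}"
  by (rule bij_betw_byWitness[where f' = nat]) auto

lemma UNIV_int_split: "(UNIV :: int set) = {0..} \<union> {..<0}" "{0..} \<inter> {..<0::int} = {}"
  by auto

lemma has_sum_int_split:
  fixes f :: "int \<Rightarrow> 'a::topological_comm_monoid_add"
  assumes "((\<lambda>n. f (int n)) has_sum a) UNIV" and "((\<lambda>n. f (- int n - 1)) has_sum b) UNIV"
  shows "(f has_sum (a + b)) UNIV"
  using has_sum_Un_disjoint[OF _ _ UNIV_int_split(2), of f a b] assms
  unfolding UNIV_int_split(1)[symmetric]
    has_sum_reindex_bij_betw[OF bij_betw_nonneg_int] has_sum_reindex_bij_betw[OF bij_betw_neg_int]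
  by blast

lemma summable_on_int_split:
  fixes f :: "int \<Rightarrow> 'a::topological_comm_monoid_add"
  assumes "(\<lambda>n. f (int n)) summable_on UNIV" and "(\<lambda>n. f (- int n - 1)) summable_on UNIV"
  shows "f summable_on UNIV"
  using assms has_sum_int_split unfolding summable_on_def by blast

lemma has_sum_int_imp_sums:
  fixes f :: "int \<Rightarrow> 'a::banach"
  assumes "(f has_sum s) UNIV"
  shows "summable (\<lambda>n. f (int n))" and "summable (\<lambda>n. f (- int n - 1))"
    and "(\<lambda>n. f (int n) + f (- int n - 1)) sums s"
proof -
  have "f summable_on {0..}" "f summable_on {..<0}"
    using assms by (auto intro: summable_on_subset_banach[of f UNIV] has_sum_imp_summable)
  then have s: "(\<lambda>n. f (int n)) summable_on UNIV" "(\<lambda>n. f (- int n - 1)) summable_on UNIV"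
    unfolding summable_on_def has_sum_reindex_bij_betw[OF bij_betw_nonneg_int]
      has_sum_reindex_bij_betw[OF bij_betw_neg_int] by auto
  then show "summable (\<lambda>n. f (int n))" "summable (\<lambda>n. f (- int n - 1))"
    by (auto intro: summable_on_imp_summable)
  obtain a b where ab: "((\<lambda>n. f (int n)) has_sum a) UNIV" "((\<lambda>n. f (- int n - 1)) has_sum b) UNIV"
    using s unfolding summable_on_def by blast
  then have "a + b = s"
    using has_sum_int_split[OF ab] assms has_sum_unique by blast
  then show "(\<lambda>n. f (int n) + f (- int n - 1)) sums s"
    using has_sum_add[OF ab] has_sum_imp_sums by blast
qed

lemma has_sum_sum:
  fixes f :: "'i \<Rightarrow> 'b \<Rightarrow> 'a::topological_comm_monoid_add"
  assumes "finite I" and "\<And>i. i \<in> I \<Longrightarrow> (f i has_sum s i) A"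
  shows "((\<lambda>x. \<Sum>i\<in>I. f i x) has_sum (\<Sum>i\<in>I. s i)) A"
  using assms by (induction I) (auto intro!: has_sum_add)

lemma sum_powers_root_of_unity:
  fixes j :: int and N :: nat
  assumes "0 < \<bar>j\<bar>" and "\<bar>j\<bar> < int N"
  shows "(\<Sum>k<N. (cis (2 * pi / N) powi j) ^ k) = 0"
proof -
  let ?z = "cis (2 * pi / N) powi j"
  have z: "?z = cis (of_int j * (2 * pi / N))"
    by (simp add: cis_power_int)
  have "N > 0" using assms by simp
  have "?z ^ N = cis (2 * pi * of_int j)"
    unfolding z Complex.DeMoivre using \<open>N > 0\<close> by (simp add: field_simps)
  then have zN: "?z ^ N = 1"
    by (simp add: cis_multiple_2pi)
  have "?z \<noteq> 1"
  proof
    assume "?z = 1"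
    then have "exp (\<i> * of_real (of_int j * (2 * pi / N))) = 1"
      unfolding z by (simp add: cis_conv_exp)
    then obtain n :: int where "of_int j * (2 * pi / N) = of_int (2 * n) * pi"
      unfolding exp_eq_1 by auto
    then have "real_of_int j = of_int n * N"
      using \<open>N > 0\<close> by (simp add: field_simps)
    then have "real_of_int j = real_of_int (n * int N)" by simp
    then have "j = n * int N" by (simp only: of_int_eq_iff)
    then show False
      using assms zdvd_imp_le[of "int N" "\<bar>j\<bar>"] by simp
  qed
  then show ?thesis
    using geometric_sum[of ?z N] zN by simp
qed

text \<open>Averaging the series over the rotations of \<open>z\<close> by the \<open>N\<close>-th roots of unity \<open>\<omega>\<^sup>k\<close>, with weights
  \<open>\<omega>\<^sup>-\<^sup>m\<^sup>k\<close>, keeps the term \<open>n = m\<close> and removes all terms with \<open>0 < \<bar>n - m\<bar> < N\<close>. What remains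
  besides the term \<open>n = m\<close> is part of a tail of an absolutely convergent series.\<close>

lemma laurent_zero_scalar:
  fixes d :: "int \<Rightarrow> complex"
  assumes \<rho>: "\<rho> > 0" and zero: "\<And>z. cmod z = \<rho> \<Longrightarrow> ((\<lambda>n. z powi n * d n) has_sum 0) UNIV"
  shows "d m = 0"
proof -
  define a where "a n = of_real \<rho> powi n * d n" for n
  have "(a has_sum 0) UNIV"
    unfolding a_def using zero[of "of_real \<rho>"] \<rho> by simp
  then have abs: "(\<lambda>n. norm (a n)) summable_on UNIV"
    unfolding summable_on_iff_abs_summable_on_complex[symmetric] by (rule has_sum_imp_summable)
  have "norm (a m) \<le> e" if e: "e > 0" for e
  proof -
    obtain F where F: "finite F" "dist (\<Sum>n\<in>F. norm (a n)) (\<Sum>\<^sub>\<infinity>n. norm (a n)) \<le> e"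
      using infsum_finite_approximation[OF abs e] by blast
    have tail: "(\<Sum>\<^sub>\<infinity>n\<in>- F. norm (a n)) \<le> e"
    proof -
      have "(\<Sum>\<^sub>\<infinity>n\<in>F \<union> - F. norm (a n)) = (\<Sum>n\<in>F. norm (a n)) + (\<Sum>\<^sub>\<infinity>n\<in>- F. norm (a n))"
        using F(1) by (subst infsum_Un_disjoint)
          (auto intro!: summable_on_subset_banach[OF abs])
      then show ?thesis using F(2) by (simp add: dist_real_def)
    qed
    obtain N :: nat where N: "N > 0" "\<And>n. n \<in> F \<Longrightarrow> \<bar>n - m\<bar> < int N"
    proof -
      have "finite ((\<lambda>n. nat \<bar>n - m\<bar>) ` F)" using F(1) by simp
      then obtain k where k: "\<And>n. n \<in> F \<Longrightarrow> nat \<bar>n - m\<bar> \<le> k"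
        unfolding finite_nat_set_iff_bounded_le by auto
      show thesis
        by (rule that[of "Suc k"]) (use k in force)+
    qed
    define \<omega> where "\<omega> = cis (2 * pi / N)"
    have \<omega>: "cmod (\<omega> powi j) = 1" "\<omega> \<noteq> 0" for j
      by (simp_all add: \<omega>_def norm_power_int)
    \<comment> \<open>The coefficient of \<open>a n\<close> in the sum over the rotations: \<open>N\<close> for \<open>n = m\<close>, and \<open>0\<close> at all
      other points of \<open>F\<close>.\<close>
    define K where "K n = (\<Sum>k<N. (\<omega> powi (n - m)) ^ k)" for n
    have K: "norm (K n) \<le> N" "n \<in> F \<Longrightarrow> n \<noteq> m \<Longrightarrow> K n = 0" for n
    proof -
      have "norm (K n) \<le> (\<Sum>k<N. norm ((\<omega> powi (n - m)) ^ k))"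
        unfolding K_def by (rule norm_sum)
      then show "norm (K n) \<le> N" by (simp add: norm_power \<omega>)
      show "n \<in> F \<Longrightarrow> n \<noteq> m \<Longrightarrow> K n = 0"
        unfolding K_def \<omega>_def by (rule sum_powers_root_of_unity) (use N in auto)
    qed
    have abs_K: "(\<lambda>n. norm (K n * a n)) summable_on A" for A
    proof (rule Infinite_Sum.abs_summable_on_comparison_test')
      show "(\<lambda>n. N * norm (a n)) summable_on A"
        by (intro summable_on_cmult_right summable_on_subset_banach[OF abs]) auto
    qed (auto simp: norm_mult intro!: mult_right_mono K)
    have "((\<lambda>n. K n * a n) has_sum 0) UNIV"
    proof -
      have "((\<lambda>n. (\<omega> powi (- m)) ^ k * ((of_real \<rho> * \<omega> ^ k) powi n * d n)) has_sum (\<omega> powi (- m)) ^ k * 0) UNIV" for k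
        by (rule has_sum_cmult_right[OF zero]) (use \<rho> in \<open>simp add: norm_mult norm_power \<omega>_def\<close>)
      moreover have "(\<omega> powi (- m)) ^ k * ((of_real \<rho> * \<omega> ^ k) powi n * d n) = (\<omega> powi (n - m)) ^ k * a n" for k n
      proof -
        have "(\<omega> ^ k) powi n = (\<omega> powi n) ^ k"
          by (metis mult.commute power_int_mult power_int_of_nat)
        moreover have "(\<omega> powi (- m)) ^ k * (\<omega> powi n) ^ k = (\<omega> powi (n - m)) ^ k"
          using \<omega>(2) by (simp add: power_int_add[symmetric] flip: power_mult_distrib)
        ultimately show ?thesis
          by (simp add: a_def power_int_mult_distrib mult_ac)
      qed
      ultimately have "((\<lambda>n. (\<omega> powi (n - m)) ^ k * a n) has_sum 0) UNIV" for k
        by simp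
      then show ?thesis
        unfolding K_def sum_distrib_right
        using has_sum_sum[where I = "{..<N}" and f = "\<lambda>k n. (\<omega> powi (n - m)) ^ k * a n" and s = "\<lambda>_. 0"]
        by simp
    qed
    then have "((\<lambda>n. K n * a n) has_sum (0 - K m * a m)) (UNIV - {m})"
      by (rule has_sum_Diff) (auto simp: has_sum_finite_iff)
    then have "- (N * a m) = (\<Sum>\<^sub>\<infinity>n\<in>UNIV - {m}. K n * a n)"
      by (simp add: infsumI K_def)
    also have "norm \<dots> \<le> (\<Sum>\<^sub>\<infinity>n\<in>UNIV - {m}. norm (K n * a n))"
      by (rule norm_infsum_bound[OF abs_K])
    also have "\<dots> \<le> (\<Sum>\<^sub>\<infinity>n\<in>- F. N * norm (a n))"
    proof (rule infsum_mono_neutral)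
      show "(\<lambda>n. norm (K n * a n)) summable_on UNIV - {m}"
        by (rule abs_K)
      show "(\<lambda>n. N * norm (a n)) summable_on - F"
        by (intro summable_on_cmult_right summable_on_subset_banach[OF abs]) auto
    qed (use K in \<open>auto simp: norm_mult intro!: mult_right_mono\<close>)
    also have "\<dots> = N * (\<Sum>\<^sub>\<infinity>n\<in>- F. norm (a n))"
      by (rule infsum_cmult_right) (auto intro: summable_on_subset_banach[OF abs])
    also have "\<dots> \<le> N * e" using tail by (intro mult_left_mono) auto
    finally show ?thesis using N(1) by (simp add: norm_mult)
  qed
  then have "norm (a m) \<le> 0" by (metis field_le_epsilon add.left_neutral)
  then show ?thesis using \<rho> by (simp add: a_def)
qed

text \<open>Pairing the difference of the two series with the vector \<open>c m - c' m\<close> reduces the claim to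
  scalar coefficients.\<close>

lemma laurent_expansion_unique:
  fixes c c' :: "int \<Rightarrow> 'e::chilbert_space"
  assumes r: "0 < r" "r < 1" and c: "laurent_expansion r g c" and c': "laurent_expansion r g c'"
  shows "c = c'"
proof
  fix m
  let ?\<rho> = "(1 + r) / 2"
  have "cinner (c m - c' m) (c m - c' m) = 0"
  proof (rule laurent_zero_scalar[where \<rho> = ?\<rho> and d = "\<lambda>n. cinner (c n - c' n) (c m - c' m)"])
    fix z :: complex assume "cmod z = ?\<rho>"
    then have "z \<in> annulus r" using r by (simp add: annulus_def)
    then have "((\<lambda>n. z powi n *\<^sub>C c n - z powi n *\<^sub>C c' n) has_sum (g z - g z)) UNIV"
      using has_sum_add[where f = "\<lambda>n. z powi n *\<^sub>C c n" and g = "\<lambda>n. - (z powi n *\<^sub>C c' n)"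
          and a = "g z" and b = "- g z"] c c'
      unfolding laurent_expansion_def by (simp add: has_sum_uminus)
    from has_sum_bounded_linear[OF bounded_bilinear.bounded_linear_left[OF bounded_bilinear_cinner] this]
    show "((\<lambda>n. z powi n * cinner (c n - c' n) (c m - c' m)) has_sum 0) UNIV"
      by (simp flip: scaleC_diff_right add: cinner_scaleC_left)
  qed (use r in simp)
  then show "c m = c' m" by simp
qed

lemma laurent_coeff_eq:
  assumes "0 < r" "r < 1" and "laurent_expansion r g c"
  shows "laurent_coeff r g = c"
  unfolding laurent_coeff_def
  by (rule the_equality) (use assms laurent_expansion_unique in blast)+

text \<open>Termwise differentiation: on a disc around \<open>z\<^sub>0\<close> inside the annulus the differentiated series is
  dominated by \<open>\<Sum> n q\<^sup>n\<close>, since the terms of the series at slightly larger and slightly smaller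
  radii are bounded.\<close>

lemma laurent_expansion_analytic:
  fixes c :: "int \<Rightarrow> 'e::chilbert_space"
  assumes r: "0 < r" and exp: "laurent_expansion r g c"
  shows "analytic_vec (annulus r) g"
  unfolding analytic_vec_def
proof
  fix z\<^sub>0 assume "z\<^sub>0 \<in> annulus r"
  then have z\<^sub>0: "r < norm z\<^sub>0" "norm z\<^sub>0 < 1" by (auto simp: annulus_def)
  \<comment> \<open>Radii \<open>r < s' < s \<le> \<bar>z\<bar> \<le> t < t' < 1\<close>: the terms are bounded at the radii \<open>t'\<close> and \<open>s'\<close>,
    the differentiated series is estimated between \<open>s\<close> and \<open>t\<close>.\<close>
  define \<epsilon> where "\<epsilon> = min (norm z\<^sub>0 - r) (1 - norm z\<^sub>0) / 2"
  have \<epsilon>: "\<epsilon> > 0" "r < norm z\<^sub>0 - \<epsilon>" "norm z\<^sub>0 + \<epsilon> < 1" using z\<^sub>0 by (auto simp: \<epsilon>_def min_def field_simps)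
  define s where "s = norm z\<^sub>0 - \<epsilon>"
  define t where "t = norm z\<^sub>0 + \<epsilon>"
  define s' where "s' = (r + s) / 2"
  define t' where "t' = (t + 1) / 2"
  have radii: "r < s'" "s' < s" "0 < s" "s \<le> t" "t < t'" "t' < 1" "0 < t" "0 < s'" "0 < t'" "s' < 1"
    using \<epsilon> r z\<^sub>0 by (auto simp: s_def t_def s'_def t'_def)
  have ball: "s \<le> norm z" "norm z \<le> t" if "z \<in> ball z\<^sub>0 \<epsilon>" for z
    using that norm_triangle_ineq2[of z\<^sub>0 z] norm_triangle_ineq2[of z z\<^sub>0]
    by (auto simp: s_def t_def dist_norm norm_minus_commute)
  have S: "((\<lambda>n. z powi n *\<^sub>C c n) has_sum g z) UNIV" if "r < norm z" "norm z < 1" for z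
    using that exp by (auto simp: laurent_expansion_def annulus_def)
  obtain B\<^sub>1 where B\<^sub>1: "\<And>n. norm (of_real t' powi int n *\<^sub>C c (int n)) \<le> B\<^sub>1"
  proof -
    have "summable (\<lambda>n. of_real t' powi int n *\<^sub>C c (int n))"
      by (rule has_sum_int_imp_sums(1)[OF S]) (use radii in auto)
    then have "Bseq (\<lambda>n. of_real t' powi int n *\<^sub>C c (int n))"
      using summable_LIMSEQ_zero convergentI convergent_imp_Bseq by blast
    with that show thesis by (auto simp: Bseq_def)
  qed
  obtain B\<^sub>2 where B\<^sub>2: "\<And>n. norm (of_real s' powi (- int n - 1) *\<^sub>C c (- int n - 1)) \<le> B\<^sub>2"
  proof -
    have "summable (\<lambda>n. of_real s' powi (- int n - 1) *\<^sub>C c (- int n - 1))"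
      by (rule has_sum_int_imp_sums(2)[OF S]) (use radii in auto)
    then have "Bseq (\<lambda>n. of_real s' powi (- int n - 1) *\<^sub>C c (- int n - 1))"
      using summable_LIMSEQ_zero convergentI convergent_imp_Bseq by blast
    with that show thesis by (auto simp: Bseq_def)
  qed
  define f where "f n z = z powi int n *\<^sub>C c (int n) + z powi (- int n - 1) *\<^sub>C c (- int n - 1)" for n z
  define d where "d n z = (of_int (int n) * z powi (int n - 1)) *\<^sub>C c (int n)
      + (of_int (- int n - 1) * z powi (- int n - 1 - 1)) *\<^sub>C c (- int n - 1)" for n z
  have deriv_term: "((\<lambda>z. z powi k *\<^sub>C e) has_derivative (\<lambda>h. h *\<^sub>C (of_int k * z powi (k - 1)) *\<^sub>C e)) (at z within ball z\<^sub>0 \<epsilon>)"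
    if "z \<noteq> 0" for z :: complex and k and e :: 'e
    by (rule has_derivative_eq_rhs[OF bounded_linear.has_derivative[OF
          bounded_bilinear.bounded_linear_left[OF bounded_bilinear_scaleC]
          has_derivative_power_int'[OF that]]]) (simp add: scaleC_scaleC)
  have deriv: "(f n has_derivative (\<lambda>h. h *\<^sub>C d n z)) (at z within ball z\<^sub>0 \<epsilon>)" if "z \<in> ball z\<^sub>0 \<epsilon>" for n z
  proof -
    have "z \<noteq> 0" using ball[OF that] radii by auto
    then show ?thesis
      unfolding f_def d_def scaleC_add_right
      by (intro has_derivative_add deriv_term)
  qed
  define M where "M n = (B\<^sub>1 / t) * (real (Suc n) * (t / t') ^ n)
      + (B\<^sub>2 / s) * (real (Suc n) * (s' / s) ^ n)" for n
  have "summable M"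
    unfolding M_def
    by (intro summable_add summable_mult sums_summable[OF geometric_deriv_sums]) (use radii in auto)
  have d_le: "norm (d n z) \<le> M n" if "z \<in> ball z\<^sub>0 \<epsilon>" for n z
  proof -
    note zb = ball[OF that]
    have z: "norm z > 0" using zb radii by linarith
    have "norm ((of_int (int n) * z powi (int n - 1)) *\<^sub>C c (int n)) \<le> (B\<^sub>1 / t) * (real (Suc n) * (t / t') ^ n)"
    proof (cases n)
      case 0
      have "0 \<le> B\<^sub>1" using B\<^sub>1[of 0] order_trans norm_ge_zero by blast
      then show ?thesis using 0 radii by simp
    next
      case (Suc k)
      have "norm (z powi (int n - 1)) \<le> t ^ k"
        using zb Suc by (simp add: norm_power power_mono)
      moreover have "norm (c (int n)) \<le> B\<^sub>1 / t' ^ n"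
        using B\<^sub>1[of n] radii by (simp add: norm_power field_simps)
      ultimately have "real n * norm (z powi (int n - 1)) * norm (c (int n)) \<le> real (Suc n) * t ^ k * (B\<^sub>1 / t' ^ n)"
        using radii by (intro mult_mono) auto
      also have "\<dots> = (B\<^sub>1 / t) * (real (Suc n) * (t / t') ^ n)"
        using radii Suc by (simp add: power_divide field_simps)
      finally show ?thesis by (simp add: norm_mult)
    qed
    moreover have "norm ((of_int (- int n - 1) * z powi (- int n - 1 - 1)) *\<^sub>C c (- int n - 1))
        \<le> (B\<^sub>2 / s) * (real (Suc n) * (s' / s) ^ n)"
    proof -
      have e: "(- int n - 1 - 1) = - int (n + 2)" "- int n - 1 = - int (n + 1)" by auto
      have "norm (z powi (- int n - 1 - 1)) \<le> 1 / s ^ (n + 2)"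
      proof -
        have "norm (z powi (- int (n + 2))) = 1 / norm z ^ (n + 2)"
          by (simp only: power_int_minus power_int_of_nat norm_inverse norm_power inverse_eq_divide norm_divide norm_one)
        also have "\<dots> \<le> 1 / s ^ (n + 2)"
          using zb radii z by (intro divide_left_mono power_mono mult_pos_pos zero_less_power) auto
        finally show ?thesis by (simp only: e(1))
      qed
      moreover have "norm (c (- int n - 1)) \<le> B\<^sub>2 * s' ^ (n + 1)"
      proof -
        have pow: "norm (of_real s' powi (- int n - 1) :: complex) = 1 / s' ^ (n + 1)"
          using radii by (simp only: e(2) power_int_minus power_int_of_nat norm_inverse norm_power
              inverse_eq_divide norm_divide norm_one norm_of_real abs_of_pos)
        have "1 / s' ^ (n + 1) * norm (c (- int n - 1)) \<le> B\<^sub>2"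
          using B\<^sub>2[of n] by (simp only: norm_scaleC pow)
        then show ?thesis
          using radii by (simp add: field_simps)
      qed
      moreover have "norm (of_int (- int n - 1) :: complex) = real (Suc n)"
        by (simp only: norm_of_int)
      ultimately have "norm (of_int (- int n - 1) :: complex) * norm (z powi (- int n - 1 - 1)) * norm (c (- int n - 1))
          \<le> real (Suc n) * (1 / s ^ (n + 2)) * (B\<^sub>2 * s' ^ (n + 1))"
        using radii by (intro mult_mono) auto
      also have "\<dots> = (B\<^sub>2 / s) * (real (Suc n) * (s' / s) ^ n) * (s' / s)"
        using radii by (simp add: power_divide field_simps)
      also have "\<dots> \<le> (B\<^sub>2 / s) * (real (Suc n) * (s' / s) ^ n) * 1"
      proof -
        have "0 \<le> B\<^sub>2" using B\<^sub>2[of 0] order_trans norm_ge_zero by blast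
        then show ?thesis using radii by (intro mult_left_mono) auto
      qed
      finally show ?thesis by (simp add: norm_mult del: of_int_diff of_int_minus)
    qed
    ultimately show ?thesis
      unfolding d_def M_def by (intro norm_triangle_le add_mono)
  qed
  have unif: "uniform_limit (ball z\<^sub>0 \<epsilon>) (\<lambda>n z. \<Sum>i<n. d i z) (\<lambda>z. \<Sum>i. d i z) sequentially"
    by (rule Weierstrass_m_test[OF _ \<open>summable M\<close>]) (use d_le in auto)
  have sums: "(\<lambda>n. f n z) sums g z" if "z \<in> ball z\<^sub>0 \<epsilon>" for z
    unfolding f_def
    by (rule has_sum_int_imp_sums(3)[OF S]) (use ball[OF that] radii in linarith)+
  have "\<exists>G. \<forall>z\<in>ball z\<^sub>0 \<epsilon>. (\<lambda>n. f n z) sums G z \<and>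
      (G has_derivative (\<lambda>h. h *\<^sub>C (\<Sum>i. d i z))) (at z within ball z\<^sub>0 \<epsilon>)"
  proof (rule has_derivative_series[where f' = "\<lambda>n z h. h *\<^sub>C d n z"])
    show "\<forall>\<^sub>F n in sequentially. \<forall>z\<in>ball z\<^sub>0 \<epsilon>. \<forall>h. norm ((\<Sum>i<n. h *\<^sub>C d i z) - h *\<^sub>C (\<Sum>i. d i z)) \<le> e * norm h"
      if "e > 0" for e
    proof -
      from unif that have "\<forall>\<^sub>F n in sequentially. \<forall>z\<in>ball z\<^sub>0 \<epsilon>. dist (\<Sum>i<n. d i z) (\<Sum>i. d i z) < e"
        by (simp add: uniform_limit_iff)
      then show ?thesis
      proof eventually_elim
        case (elim n)
        have "norm ((\<Sum>i<n. h *\<^sub>C d i z) - h *\<^sub>C (\<Sum>i. d i z)) \<le> e * norm h" if "z \<in> ball z\<^sub>0 \<epsilon>" for z h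
        proof -
          have "(\<Sum>i<n. h *\<^sub>C d i z) = h *\<^sub>C (\<Sum>i<n. d i z)"
            by (induction n) (simp_all add: scaleC_add_right)
          then have "norm ((\<Sum>i<n. h *\<^sub>C d i z) - h *\<^sub>C (\<Sum>i. d i z)) = norm h * dist (\<Sum>i<n. d i z) (\<Sum>i. d i z)"
            by (simp add: dist_norm flip: scaleC_diff_right)
          then show ?thesis
            using elim that mult_left_mono[of "dist (\<Sum>i<n. d i z) (\<Sum>i. d i z)" e "norm h"]
            by (simp add: mult.commute less_imp_le)
        qed
        then show ?case by blast
      qed
    qed
    show "z\<^sub>0 \<in> ball z\<^sub>0 \<epsilon>" using \<epsilon> by simp
    then show "(\<lambda>n. f n z\<^sub>0) sums g z\<^sub>0" by (rule sums)
  qed (auto intro: deriv)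
  then obtain G where G: "\<And>z. z \<in> ball z\<^sub>0 \<epsilon> \<Longrightarrow> (\<lambda>n. f n z) sums G z"
    "(G has_derivative (\<lambda>h. h *\<^sub>C (\<Sum>i. d i z\<^sub>0))) (at z\<^sub>0 within ball z\<^sub>0 \<epsilon>)"
    using \<epsilon> by (metis centre_in_ball)
  have "G z = g z" if "z \<in> ball z\<^sub>0 \<epsilon>" for z
    using G(1)[OF that] sums[OF that] sums_unique2 by blast
  then have "(g has_derivative (\<lambda>h. h *\<^sub>C (\<Sum>i. d i z\<^sub>0))) (at z\<^sub>0 within ball z\<^sub>0 \<epsilon>)"
    using \<epsilon> by (intro has_derivative_transform[OF _ _ G(2)]) auto
  then show "\<exists>d. (g has_derivative (\<lambda>h. h *\<^sub>C d)) (at z\<^sub>0)"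
    using \<epsilon> at_within_open[of z\<^sub>0 "ball z\<^sub>0 \<epsilon>"] by auto
qed

section \<open>The Hardy space of the annulus\<close>

text \<open>Through their Laurent coefficients the elements of \<open>H\<^sup>2\<^sub>r(\<bbbA>, E)\<close> correspond to these weighted
  square-summable sequences.\<close>

definition hardy_seq :: "real \<Rightarrow> 'e::chilbert_space set \<Rightarrow> (int \<Rightarrow> 'e) set" where
  "hardy_seq r E = {c. (\<forall>n. c n \<in> E) \<and> (\<lambda>n. hardy_weight r n * (norm (c n))\<^sup>2) summable_on UNIV}"

definition hardy_fun :: "real \<Rightarrow> (int \<Rightarrow> 'e::chilbert_space) \<Rightarrow> complex \<Rightarrow> 'e" where
  "hardy_fun r c = (\<lambda>z. if z \<in> annulus r then \<Sum>\<^sub>\<infinity>n. z powi n *\<^sub>C c n else 0)"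

definition hardy_norm_sq :: "real \<Rightarrow> (int \<Rightarrow> 'e::chilbert_space) \<Rightarrow> real" where
  "hardy_norm_sq r c = (\<Sum>\<^sub>\<infinity>n. hardy_weight r n * (norm (c n))\<^sup>2)"

text \<open>The adjoint of the shift \<open>c \<mapsto> (\<lambda>n. c (n - 1))\<close> for the weighted inner product.\<close>

definition backward_shift :: "real \<Rightarrow> (int \<Rightarrow> 'e::chilbert_space) \<Rightarrow> int \<Rightarrow> 'e" where
  "backward_shift r c = (\<lambda>n. (hardy_weight r (n + 1) / hardy_weight r n) *\<^sub>R c (n + 1))"

definition mult_z_adj :: "real \<Rightarrow> (complex \<Rightarrow> 'e::chilbert_space) \<Rightarrow> complex \<Rightarrow> 'e" where
  "mult_z_adj r g = hardy_fun r (backward_shift r (laurent_coeff r g))"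

lemma scaleC_apply: "(a *\<^sub>C f) x = a *\<^sub>C f x"
  by (simp add: scaleC_fun_def)

lemma infsum_scaleC:
  fixes f :: "'b \<Rightarrow> 'e::chilbert_space"
  assumes "f summable_on A"
  shows "(\<Sum>\<^sub>\<infinity>n\<in>A. a *\<^sub>C f n) = a *\<^sub>C infsum f A"
  using has_sum_bounded_linear[OF bounded_bilinear.bounded_linear_right[OF bounded_bilinear_scaleC]
      has_sum_infsum[OF assms]]
  by (rule infsumI)

lemma bij_int_add: "bij (\<lambda>n::int. n + k)"
  by (rule bij_betw_byWitness[where f' = "\<lambda>n. n - k"]) auto

lemma hardy_weight_nat: "hardy_weight r (int n) = 1 - r\<^sup>2"
  by (simp add: hardy_weight_def)

lemma hardy_seq_mono: "c \<in> hardy_seq r E \<Longrightarrow> c \<in> hardy_seq r UNIV"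
  by (simp add: hardy_seq_def)

context
  fixes r :: real
  assumes r: "0 < r" "r < 1"
begin

lemma one_minus_r_sq: "0 < 1 - r\<^sup>2"
  using r by (simp add: power_less_one_iff)

lemma hardy_weight_pos: "0 < hardy_weight r n"
  using r one_minus_r_sq by (simp add: hardy_weight_def)

lemma hardy_weight_neg: "hardy_weight r (- int n - 1) = (1 - r\<^sup>2) / (r\<^sup>2) ^ n"
proof -
  have "r powi (2 * (- int n - 1) + 2) = r powi (- int (2 * n))" by simp
  also have "\<dots> = 1 / r ^ (2 * n)"
    by (simp only: power_int_minus power_int_of_nat inverse_eq_divide)
  finally show ?thesis by (simp add: hardy_weight_def power_mult)
qed

lemma hardy_weight_step:
  "hardy_weight r (n + 1) = (if n \<ge> - 1 then hardy_weight r n else r\<^sup>2 * hardy_weight r n)"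
proof (cases "n \<ge> - 1")
  case True
  then show ?thesis by (cases "n = - 1") (auto simp: hardy_weight_def)
next
  case False
  then obtain k where k: "n = - int k - 1 - 1"
    by (intro that[of "nat (- n - 2)"]) auto
  have "n + 1 = - int k - 1" "n = - int (Suc k) - 1" using k by auto
  then show ?thesis using False r by (simp only: hardy_weight_neg) simp
qed

lemma hardy_weight_decreasing: "hardy_weight r (n + 1) \<le> hardy_weight r n"
  using r hardy_weight_pos[of n] mult_left_le_one_le[of "hardy_weight r n" "r\<^sup>2"] one_minus_r_sq
  by (auto simp: hardy_weight_step)

text \<open>The reciprocal weights satisfy the recursion with characteristic roots \<open>1\<close> and \<open>r\<^sup>-\<^sup>2\<close>
  except at \<open>0\<close>, where the two geometric branches meet.\<close>

lemma hardy_weight_recurrence: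
  "- 1 / hardy_weight r (n - 2) + (1 + r\<^sup>2) / hardy_weight r (n - 1) - r\<^sup>2 / hardy_weight r n
    = (if n = 0 then 1 else 0)"
proof -
  have 1: "hardy_weight r n = (if n \<ge> 0 then hardy_weight r (n - 1) else r\<^sup>2 * hardy_weight r (n - 1))"
    using hardy_weight_step[of "n - 1"] by simp
  have 2: "hardy_weight r (n - 1) = (if n \<ge> 1 then hardy_weight r (n - 2) else r\<^sup>2 * hardy_weight r (n - 2))"
    using hardy_weight_step[of "n - 2"] by simp
  have 3: "hardy_weight r 0 = 1 - r\<^sup>2" by (simp add: hardy_weight_def)
  have w: "hardy_weight r k \<noteq> 0" for k using hardy_weight_pos[of k] by simp
  consider "n = 0" | "n \<ge> 1" | "n < 0" by linarith
  then show ?thesis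
  proof cases
    case 1
    then have n1: "hardy_weight r (n - 1) = 1 - r\<^sup>2" and n0: "hardy_weight r n = 1 - r\<^sup>2"
      using hardy_weight_step[of "- 1"] 3 by simp_all
    have "1 - r\<^sup>2 = r\<^sup>2 * hardy_weight r (n - 2)"
      using 1 2 n1 by simp
    then have n2: "hardy_weight r (n - 2) = (1 - r\<^sup>2) / r\<^sup>2"
      using r by (simp add: field_simps)
    show ?thesis
      unfolding n0 n1 n2 using 1 r one_minus_r_sq by (simp add: field_simps)
  next
    case 2
    then show ?thesis
      using \<open>hardy_weight r n = _\<close> \<open>hardy_weight r (n - 1) = _\<close> w[of "n - 2"] by (simp add: field_simps)
  next
    case 3
    then show ?thesis
      using \<open>hardy_weight r n = _\<close> \<open>hardy_weight r (n - 1) = _\<close> w[of "n - 2"] r by (simp add: field_simps)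
  qed
qed

text \<open>By the inequality of arithmetic and geometric means \<open>\<bar>z\<bar>\<^sup>n \<parallel>c\<^sub>n\<parallel>\<close> is at most
  \<open>\<bar>z\<bar>\<^sup>2\<^sup>n / w\<^sub>n + w\<^sub>n \<parallel>c\<^sub>n\<parallel>\<^sup>2\<close>. The first part consists of two geometric series, with ratios
  \<open>\<bar>z\<bar>\<^sup>2 < 1\<close> and \<open>(r / \<bar>z\<bar>)\<^sup>2 < 1\<close>.\<close>

lemma laurent_terms_summable:
  fixes c :: "int \<Rightarrow> 'e::chilbert_space"
  assumes c: "c \<in> hardy_seq r UNIV" and z: "z \<in> annulus r"
  shows "(\<lambda>n. norm (z powi n *\<^sub>C c n)) summable_on UNIV"
proof -
  have z: "r < norm z" "norm z < 1" using z by (auto simp: annulus_def)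
  have z0: "norm z > 0" using z r by linarith
  let ?q = "\<lambda>n. (norm (z powi n))\<^sup>2 / hardy_weight r n"
  have q: "?q summable_on UNIV"
  proof (rule summable_on_int_split)
    have "summable (\<lambda>n. ((norm z)\<^sup>2) ^ n * (1 / (1 - r\<^sup>2)))"
      using z by (intro summable_mult2 summable_geometric) (simp add: power_less_one_iff)
    moreover have "?q (int n) = ((norm z)\<^sup>2) ^ n * (1 / (1 - r\<^sup>2))" for n
      by (simp add: hardy_weight_nat norm_power power_mult[symmetric] mult.commute)
    ultimately have "summable (\<lambda>n. ?q (int n))" by simp
    then show "(\<lambda>n. ?q (int n)) summable_on UNIV"
      by (rule summable_nonneg_imp_summable_on) (simp add: hardy_weight_pos less_imp_le)
    have "summable (\<lambda>n. ((r / norm z)\<^sup>2) ^ n * (1 / ((norm z)\<^sup>2 * (1 - r\<^sup>2))))"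
      using z r z0 by (intro summable_mult2 summable_geometric) (simp add: power_less_one_iff)
    moreover have "?q (- int n - 1) = ((r / norm z)\<^sup>2) ^ n * (1 / ((norm z)\<^sup>2 * (1 - r\<^sup>2)))" for n
    proof -
      have "- int n - 1 = - int (n + 1)" by simp
      then have "norm (z powi (- int n - 1)) = 1 / norm z ^ (n + 1)"
        by (simp only: power_int_minus power_int_of_nat norm_inverse norm_power inverse_eq_divide
            norm_divide norm_one)
      then have "?q (- int n - 1) = (1 / norm z ^ (n + 1))\<^sup>2 / ((1 - r\<^sup>2) / (r\<^sup>2) ^ n)"
        by (simp only: hardy_weight_neg)
      also have "\<dots> = ((r / norm z)\<^sup>2) ^ n * (1 / ((norm z)\<^sup>2 * (1 - r\<^sup>2)))"
        using z0 one_minus_r_sq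
        by (simp add: power_divide power_mult_distrib power_mult[symmetric] field_simps)
      finally show ?thesis .
    qed
    ultimately have "summable (\<lambda>n. ?q (- int n - 1))" by simp
    then show "(\<lambda>n. ?q (- int n - 1)) summable_on UNIV"
      by (rule summable_nonneg_imp_summable_on) (simp add: hardy_weight_pos less_imp_le)
  qed
  show ?thesis
  proof (rule summable_on_comparison_test)
    show "(\<lambda>n. ?q n + hardy_weight r n * (norm (c n))\<^sup>2) summable_on UNIV"
      using c by (intro summable_on_add q) (simp add: hardy_seq_def)
    show "norm (z powi n *\<^sub>C c n) \<le> ?q n + hardy_weight r n * (norm (c n))\<^sup>2" for n
    proof -
      let ?a = "norm (z powi n)" and ?w = "hardy_weight r n" and ?b = "norm (c n)"
      have "2 * (?a * ?b) * ?w \<le> ?a\<^sup>2 + (?w * ?b)\<^sup>2"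
        using zero_le_power2[of "?a - ?w * ?b"] by (simp add: power2_diff algebra_simps)
      then have "2 * (?a * ?b) \<le> ?a\<^sup>2 / ?w + ?w * ?b\<^sup>2"
        using hardy_weight_pos[of n] by (simp add: field_simps power2_eq_square)
      moreover have "0 \<le> ?a * ?b" by simp
      ultimately have "?a * ?b \<le> ?a\<^sup>2 / ?w + ?w * ?b\<^sup>2" by linarith
      then show ?thesis by simp
    qed
  qed simp
qed

lemma laurent_expansion_hardy_fun:
  assumes "c \<in> hardy_seq r UNIV"
  shows "laurent_expansion r (hardy_fun r c) c"
  unfolding laurent_expansion_def hardy_fun_def
  using abs_summable_summable[OF laurent_terms_summable[OF assms]] by auto

lemma laurent_coeff_hardy_fun:
  assumes "c \<in> hardy_seq r UNIV"
  shows "laurent_coeff r (hardy_fun r c) = c"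
  using r laurent_expansion_hardy_fun[OF assms] by (rule laurent_coeff_eq)

lemma hardy_carrier:
  fixes E :: "'e::chilbert_space set"
  assumes E: "hilbert_subset E"
  shows "hcarrier (hardy_space r E) = hardy_fun r ` hardy_seq r E"
proof
  show "hcarrier (hardy_space r E) \<subseteq> hardy_fun r ` hardy_seq r E"
  proof
    fix g assume "g \<in> hcarrier (hardy_space r E)"
    then obtain c where g: "\<And>z. z \<notin> annulus r \<Longrightarrow> g z = 0" "laurent_expansion r g c"
      and c: "c \<in> hardy_seq r E"
      by (auto simp: hardy_space_def hardy_seq_def)
    have "g = hardy_fun r c"
      using g by (auto simp: hardy_fun_def laurent_expansion_def fun_eq_iff infsumI)
    with c show "g \<in> hardy_fun r ` hardy_seq r E" by blast
  qed
  show "hardy_fun r ` hardy_seq r E \<subseteq> hcarrier (hardy_space r E)"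
  proof
    fix g assume "g \<in> hardy_fun r ` hardy_seq r E"
    then obtain c where g: "g = hardy_fun r c" and c: "c \<in> hardy_seq r E" by blast
    have exp: "laurent_expansion r g c"
      unfolding g by (rule laurent_expansion_hardy_fun[OF hardy_seq_mono[OF c]])
    have "g z \<in> E" if "z \<in> annulus r" for z
    proof -
      have "((\<lambda>n. z powi n *\<^sub>C c n) has_sum g z) UNIV"
        using exp that by (simp add: laurent_expansion_def)
      moreover have "sum (\<lambda>n. z powi n *\<^sub>C c n) F \<in> E" for F
        using c E by (induction F rule: infinite_finite_induct)
          (auto simp: hardy_seq_def hilbert_subset_def csubspace_def)
      ultimately show ?thesis
        using E unfolding has_sum_def hilbert_subset_def
        by (intro Lim_in_closed_set[of E _ "finite_subsets_at_top UNIV"]) auto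
    qed
    moreover have "analytic_vec (annulus r) g"
      using r(1) exp by (rule laurent_expansion_analytic)
    ultimately show "g \<in> hcarrier (hardy_space r E)"
      using exp c by (auto simp: hardy_space_def hardy_seq_def g hardy_fun_def)
  qed
qed

lemma csubspace_hardy_seq:
  fixes E :: "'e::chilbert_space set"
  assumes E: "csubspace E"
  shows "csubspace (hardy_seq r E)"
  unfolding csubspace_def
proof (intro conjI ballI allI)
  show "0 \<in> hardy_seq r E"
    using E by (simp add: hardy_seq_def csubspace_0)
  show "c + d \<in> hardy_seq r E" if cd: "c \<in> hardy_seq r E" "d \<in> hardy_seq r E" for c d
  proof -
    have "(\<lambda>n. hardy_weight r n * (norm ((c + d) n))\<^sup>2) summable_on UNIV"
    proof (rule summable_on_comparison_test)
      show "(\<lambda>n. 2 * (hardy_weight r n * (norm (c n))\<^sup>2) + 2 * (hardy_weight r n * (norm (d n))\<^sup>2)) summable_on UNIV"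
        using cd by (intro summable_on_add summable_on_cmult_right) (auto simp: hardy_seq_def)
      show "hardy_weight r n * (norm ((c + d) n))\<^sup>2
          \<le> 2 * (hardy_weight r n * (norm (c n))\<^sup>2) + 2 * (hardy_weight r n * (norm (d n))\<^sup>2)" for n
      proof -
        have "(norm (c n + d n))\<^sup>2 \<le> 2 * (norm (c n))\<^sup>2 + 2 * (norm (d n))\<^sup>2"
          using norm_sq_add[of "c n" "d n"] norm_sq_diff[of "c n" "d n"]
            zero_le_power2[of "norm (c n - d n)"] by linarith
        then show ?thesis
          using mult_left_mono[OF _ less_imp_le[OF hardy_weight_pos[of n]]] by (fastforce simp: algebra_simps)
      qed
    qed (simp add: hardy_weight_pos less_imp_le)
    then show ?thesis using cd E by (simp add: hardy_seq_def csubspace_add)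
  qed
  show "a *\<^sub>C c \<in> hardy_seq r E" if c: "c \<in> hardy_seq r E" for a c
  proof -
    have "(\<lambda>n. (cmod a)\<^sup>2 * (hardy_weight r n * (norm (c n))\<^sup>2)) summable_on UNIV"
      using c by (intro summable_on_cmult_right) (simp add: hardy_seq_def)
    then show ?thesis
      using c E by (simp add: hardy_seq_def csubspace_scale scaleC_fun_def power_mult_distrib mult_ac)
  qed
qed

lemma hardy_fun_add:
  assumes "c \<in> hardy_seq r UNIV" and "d \<in> hardy_seq r UNIV"
  shows "hardy_fun r (c + d) = hardy_fun r c + hardy_fun r d"
  unfolding hardy_fun_def fun_eq_iff
  using abs_summable_summable[OF laurent_terms_summable[OF assms(1)]]
    abs_summable_summable[OF laurent_terms_summable[OF assms(2)]]
  by (auto simp: scaleC_add_right infsum_add)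

lemma hardy_fun_scale:
  assumes "c \<in> hardy_seq r UNIV"
  shows "hardy_fun r (a *\<^sub>C c) = a *\<^sub>C hardy_fun r c"
proof
  fix z
  have "(\<Sum>\<^sub>\<infinity>n. z powi n *\<^sub>C a *\<^sub>C c n) = a *\<^sub>C (\<Sum>\<^sub>\<infinity>n. z powi n *\<^sub>C c n)" if "z \<in> annulus r"
    using infsum_scaleC[OF abs_summable_summable[OF laurent_terms_summable[OF assms that]], of a]
    by (simp add: scaleC_scaleC mult.commute)
  then show "hardy_fun r (a *\<^sub>C c) z = (a *\<^sub>C hardy_fun r c) z"
    by (auto simp: hardy_fun_def scaleC_fun_def)
qed

lemma hardy_inner_summable:
  fixes c d :: "int \<Rightarrow> 'e::chilbert_space"
  assumes c: "c \<in> hardy_seq r UNIV" and d: "d \<in> hardy_seq r UNIV"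
  shows "(\<lambda>n. complex_of_real (hardy_weight r n) * cinner (c n) (d n)) summable_on UNIV"
proof (rule abs_summable_summable, rule summable_on_comparison_test)
  show "(\<lambda>n. hardy_weight r n * (norm (c n))\<^sup>2 + hardy_weight r n * (norm (d n))\<^sup>2) summable_on UNIV"
    using c d by (intro summable_on_add) (auto simp: hardy_seq_def)
  show "norm (complex_of_real (hardy_weight r n) * cinner (c n) (d n))
      \<le> hardy_weight r n * (norm (c n))\<^sup>2 + hardy_weight r n * (norm (d n))\<^sup>2" for n
  proof -
    have "norm (c n) * norm (d n) \<le> (norm (c n))\<^sup>2 + (norm (d n))\<^sup>2"
      using zero_le_power2[of "norm (c n) - norm (d n)"] mult_nonneg_nonneg[of "norm (c n)" "norm (d n)"]
      by (simp add: power2_diff del: mult_nonneg_nonneg)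
    then have "cmod (cinner (c n) (d n)) \<le> (norm (c n))\<^sup>2 + (norm (d n))\<^sup>2"
      using norm_cinner_le order_trans by blast
    then show ?thesis
      using mult_left_mono[OF _ less_imp_le[OF hardy_weight_pos[of n]]] hardy_weight_pos[of n]
      by (fastforce simp: norm_mult algebra_simps)
  qed
qed simp

lemma hinner_hardy_fun:
  assumes "c \<in> hardy_seq r UNIV" and "d \<in> hardy_seq r UNIV"
  shows "hinner (hardy_space r E) (hardy_fun r c) (hardy_fun r d)
    = (\<Sum>\<^sub>\<infinity>n. complex_of_real (hardy_weight r n) * cinner (c n) (d n))"
  by (simp add: hardy_space_def laurent_coeff_hardy_fun assms)

lemma hinner_hardy_fun_self:
  fixes c :: "int \<Rightarrow> 'e::chilbert_space"
  assumes "c \<in> hardy_seq r UNIV"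
  shows "hinner (hardy_space r E) (hardy_fun r c) (hardy_fun r c) = complex_of_real (hardy_norm_sq r c)"
proof -
  have "((\<lambda>n. hardy_weight r n * (norm (c n))\<^sup>2) has_sum hardy_norm_sq r c) UNIV"
    using assms by (simp add: hardy_norm_sq_def hardy_seq_def)
  from has_sum_of_real[OF this, where 'a = complex] show ?thesis
    unfolding hinner_hardy_fun[OF assms assms] by (intro infsumI) (simp add: cinner_norm)
qed

lemma pre_hilbert_hardy_space:
  fixes E :: "'e::chilbert_space set"
  assumes E: "hilbert_subset E"
  shows "pre_hilbert (hardy_space r E)"
proof
  let ?H = "hardy_space r E"
  have sub: "csubspace (hardy_seq r E)"
    using E by (simp add: hilbert_subset_def csubspace_hardy_seq)
  note carrier = hardy_carrier[OF E]
  show "csubspace (hcarrier ?H)"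
    unfolding csubspace_def
  proof (intro conjI ballI allI)
    show "0 \<in> hcarrier ?H"
      unfolding carrier using csubspace_0[OF sub]
      by (rule rev_image_eqI) (simp add: hardy_fun_def fun_eq_iff)
    show "x + y \<in> hcarrier ?H" if "x \<in> hcarrier ?H" "y \<in> hcarrier ?H" for x y
      using that csubspace_add[OF sub] unfolding carrier
      by (auto simp flip: hardy_fun_add[OF hardy_seq_mono hardy_seq_mono])
    show "a *\<^sub>C x \<in> hcarrier ?H" if "x \<in> hcarrier ?H" for a x
      using that csubspace_scale[OF sub] unfolding carrier
      by (auto simp flip: hardy_fun_scale[OF hardy_seq_mono])
  qed
  have subU: "csubspace (hardy_seq r (UNIV :: 'e set))"
    by (rule csubspace_hardy_seq) simp
  fix x y z :: "complex \<Rightarrow> 'e" and a :: complex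
  assume "x \<in> hcarrier ?H"
  then obtain c where c: "x = hardy_fun r c" "c \<in> hardy_seq r UNIV"
    unfolding carrier using hardy_seq_mono by blast
  show "0 \<le> Re (hinner ?H x x)"
    using c by (simp add: hinner_hardy_fun_self hardy_norm_sq_def infsum_nonneg hardy_weight_pos less_imp_le)
  show "x = 0" if "hinner ?H x x = 0"
  proof -
    have "hardy_norm_sq r c = 0"
      using that c by (simp add: hinner_hardy_fun_self)
    then have "hardy_weight r n * (norm (c n))\<^sup>2 = 0" for n
      using c(2) nonneg_infsum_le_0D[of "\<lambda>n. hardy_weight r n * (norm (c n))\<^sup>2" UNIV n]
      by (simp add: hardy_norm_sq_def hardy_seq_def hardy_weight_pos less_imp_le)
    then have "c n = 0" for n
      using hardy_weight_pos[of n] by (metis less_irrefl mult_eq_0_iff norm_eq_zero power_eq_0_iff)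
    then show ?thesis by (simp add: c hardy_fun_def fun_eq_iff)
  qed
  assume "y \<in> hcarrier ?H"
  then obtain d where d: "y = hardy_fun r d" "d \<in> hardy_seq r UNIV"
    unfolding carrier using hardy_seq_mono by blast
  show "hinner ?H (a *\<^sub>C x) y = a * hinner ?H x y"
    using c d csubspace_scale[OF subU] infsum_cmult_right[OF hardy_inner_summable[of c d], of a]
    by (simp flip: hardy_fun_scale add: hinner_hardy_fun scaleC_apply cinner.expand mult_ac)
  show "hinner ?H x y = cnj (hinner ?H y x)"
    using c d by (simp add: hinner_hardy_fun flip: infsum_cnj cinner_commute)
  assume "z \<in> hcarrier ?H"
  then obtain e where e: "z = hardy_fun r e" "e \<in> hardy_seq r UNIV"
    unfolding carrier using hardy_seq_mono by blast
  show "hinner ?H (x + y) z = hinner ?H x z + hinner ?H y z"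
    using c d e csubspace_add[OF subU] 
      infsum_add[OF hardy_inner_summable[of c e] hardy_inner_summable[of d e]]
    by (simp flip: hardy_fun_add add: hinner_hardy_fun cinner.expand distrib_left)
qed

lemma hardy_seq_shift:
  assumes c: "c \<in> hardy_seq r E"
  shows "(\<lambda>n. c (n - 1)) \<in> hardy_seq r E"
proof -
  have "(\<lambda>n. hardy_weight r (n + 1) * (norm (c n))\<^sup>2) summable_on UNIV"
    by (rule summable_on_comparison_test[of "\<lambda>n. hardy_weight r n * (norm (c n))\<^sup>2"])
      (use c in \<open>auto simp: hardy_seq_def hardy_weight_pos less_imp_le hardy_weight_decreasing
        intro: mult_right_mono\<close>)
  then have "(\<lambda>n. hardy_weight r n * (norm (c (n - 1)))\<^sup>2) summable_on UNIV"
    using summable_on_reindex_bij_betw[OF bij_int_add[of 1], of "\<lambda>n. hardy_weight r n * (norm (c (n - 1)))\<^sup>2"]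
    by simp
  then show ?thesis using c by (simp add: hardy_seq_def)
qed

lemma hardy_seq_backward_shift:
  fixes E :: "'e::chilbert_space set"
  assumes E: "csubspace E" and c: "c \<in> hardy_seq r E"
  shows "backward_shift r c \<in> hardy_seq r E"
proof -
  have "(\<lambda>n. hardy_weight r n * (norm (backward_shift r c n))\<^sup>2) summable_on UNIV"
  proof (rule summable_on_comparison_test)
    show "(\<lambda>n. hardy_weight r (n + 1) * (norm (c (n + 1)))\<^sup>2) summable_on UNIV"
      using c summable_on_reindex_bij_betw[OF bij_int_add[of 1], of "\<lambda>n. hardy_weight r n * (norm (c n))\<^sup>2"]
      by (simp add: hardy_seq_def)
    show "hardy_weight r n * (norm (backward_shift r c n))\<^sup>2 \<le> hardy_weight r (n + 1) * (norm (c (n + 1)))\<^sup>2" for n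
    proof -
      have w: "0 < hardy_weight r n" "0 < hardy_weight r (n + 1)" "hardy_weight r (n + 1) / hardy_weight r n \<le> 1"
        using hardy_weight_pos hardy_weight_decreasing[of n] by simp_all
      have "hardy_weight r n * (norm (backward_shift r c n))\<^sup>2
          = (hardy_weight r (n + 1) / hardy_weight r n) * (hardy_weight r (n + 1) * (norm (c (n + 1)))\<^sup>2)"
        using w by (simp add: backward_shift_def power_mult_distrib power2_eq_square field_simps)
      also have "\<dots> \<le> 1 * (hardy_weight r (n + 1) * (norm (c (n + 1)))\<^sup>2)"
        using w by (intro mult_right_mono) auto
      finally show ?thesis by simp
    qed
  qed (simp add: hardy_weight_pos less_imp_le)
  then show ?thesis
    using c E by (simp add: hardy_seq_def backward_shift_def scaleR_scaleC csubspace_scale)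
qed

lemma mult_z_hardy_fun:
  assumes c: "c \<in> hardy_seq r UNIV"
  shows "mult_z (hardy_fun r c) = hardy_fun r (\<lambda>n. c (n - 1))"
proof
  fix z
  have "(\<Sum>\<^sub>\<infinity>n. z powi n *\<^sub>C c (n - 1)) = z *\<^sub>C (\<Sum>\<^sub>\<infinity>n. z powi n *\<^sub>C c n)" if z: "z \<in> annulus r"
  proof -
    have "z \<noteq> 0" using z r by (auto simp: annulus_def)
    have "(\<Sum>\<^sub>\<infinity>n. z powi n *\<^sub>C c (n - 1)) = (\<Sum>\<^sub>\<infinity>n. z powi (n + 1) *\<^sub>C c n)"
      using infsum_reindex_bij_betw[OF bij_int_add[of 1], of "\<lambda>n. z powi n *\<^sub>C c (n - 1)"] by simp
    also have "\<dots> = (\<Sum>\<^sub>\<infinity>n. z *\<^sub>C z powi n *\<^sub>C c n)"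
      using \<open>z \<noteq> 0\<close> by (simp add: power_int_add scaleC_scaleC mult.commute)
    also have "\<dots> = z *\<^sub>C (\<Sum>\<^sub>\<infinity>n. z powi n *\<^sub>C c n)"
      by (rule infsum_scaleC[OF abs_summable_summable[OF laurent_terms_summable[OF c z]]])
    finally show ?thesis .
  qed
  then show "mult_z (hardy_fun r c) z = hardy_fun r (\<lambda>n. c (n - 1)) z"
    by (auto simp: mult_z_def hardy_fun_def)
qed

lemma mult_z_adj_hardy_fun:
  "c \<in> hardy_seq r UNIV \<Longrightarrow> mult_z_adj r (hardy_fun r c) = hardy_fun r (backward_shift r c)"
  by (simp add: mult_z_adj_def laurent_coeff_hardy_fun)

lemma mult_z_closed:
  assumes E: "hilbert_subset E" and g: "g \<in> hcarrier (hardy_space r E)"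
  shows "mult_z g \<in> hcarrier (hardy_space r E)"
  using g unfolding hardy_carrier[OF E]
  by (auto simp: mult_z_hardy_fun hardy_seq_mono intro!: imageI hardy_seq_shift)

lemma mult_z_adj_closed:
  assumes E: "hilbert_subset E" and g: "g \<in> hcarrier (hardy_space r E)"
  shows "mult_z_adj r g \<in> hcarrier (hardy_space r E)"
  using g E unfolding hardy_carrier[OF E]
  by (auto simp: mult_z_adj_hardy_fun hardy_seq_mono hilbert_subset_def
      intro!: imageI hardy_seq_backward_shift)

lemma hinner_mult_z:
  fixes E :: "'e::chilbert_space set"
  assumes E: "hilbert_subset E"
    and g: "g \<in> hcarrier (hardy_space r E)" and h: "h \<in> hcarrier (hardy_space r E)"
  shows "hinner (hardy_space r E) (mult_z g) h = hinner (hardy_space r E) g (mult_z_adj r h)"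
proof -
  obtain c d where c: "g = hardy_fun r c" "c \<in> hardy_seq r UNIV"
    and d: "h = hardy_fun r d" "d \<in> hardy_seq r UNIV"
    using g h unfolding hardy_carrier[OF E] using hardy_seq_mono by blast
  have "hinner (hardy_space r E) (mult_z g) h
      = (\<Sum>\<^sub>\<infinity>n. complex_of_real (hardy_weight r n) * cinner (c (n - 1)) (d n))"
    using c d by (simp add: mult_z_hardy_fun hinner_hardy_fun hardy_seq_shift)
  also have "\<dots> = (\<Sum>\<^sub>\<infinity>n. complex_of_real (hardy_weight r (n + 1)) * cinner (c n) (d (n + 1)))"
    using infsum_reindex_bij_betw[OF bij_int_add[of 1],
        of "\<lambda>n. complex_of_real (hardy_weight r n) * cinner (c (n - 1)) (d n)"] by simp
  also have "\<dots> = (\<Sum>\<^sub>\<infinity>n. complex_of_real (hardy_weight r n) * cinner (c n) (backward_shift r d n))"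
    using hardy_weight_pos
    by (intro infsum_cong) (simp add: backward_shift_def cinner_scaleR_right less_imp_neq[symmetric])
  also have "\<dots> = hinner (hardy_space r E) g (mult_z_adj r h)"
    using c d by (simp add: mult_z_adj_hardy_fun hinner_hardy_fun hardy_seq_backward_shift)
  finally show ?thesis .
qed

text \<open>In terms of \<open>h\<^sub>n = w\<^sub>n c\<^sub>n\<close> the norm is \<open>\<Sum> \<parallel>h\<^sub>n\<parallel>\<^sup>2 / w\<^sub>n\<close> and the backward shift
  is a genuine shift, so that the recurrence of the reciprocal weights leaves only the term \<open>n = 0\<close>.\<close>

lemma hardy_norm_sq_defect:
  fixes c :: "int \<Rightarrow> 'e::chilbert_space"
  assumes c: "c \<in> hardy_seq r UNIV"
  shows "- hardy_norm_sq r (backward_shift r (backward_shift r c))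
      + (1 + r\<^sup>2) * hardy_norm_sq r (backward_shift r c) - r\<^sup>2 * hardy_norm_sq r c
    = ((1 - r\<^sup>2) * norm (c 0))\<^sup>2"
proof -
  let ?w = "hardy_weight r"
  define h where "h n = (?w n * norm (c n))\<^sup>2" for n
  have w: "?w n \<noteq> 0" "0 < ?w n" for n using hardy_weight_pos[of n] by simp_all
  have c1: "backward_shift r c \<in> hardy_seq r UNIV"
    by (rule hardy_seq_backward_shift[OF _ c]) simp
  have c2: "backward_shift r (backward_shift r c) \<in> hardy_seq r UNIV"
    by (rule hardy_seq_backward_shift[OF _ c1]) simp
  have N: "((\<lambda>n. ?w n * (norm (d n))\<^sup>2) has_sum hardy_norm_sq r d) UNIV"
    if "d \<in> hardy_seq r UNIV" for d :: "int \<Rightarrow> 'e"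
    using that by (simp add: hardy_norm_sq_def hardy_seq_def)
  have 0: "((\<lambda>n. h n / ?w n) has_sum hardy_norm_sq r c) UNIV"
  proof -
    have "(\<lambda>n. h n / ?w n) = (\<lambda>n. ?w n * (norm (c n))\<^sup>2)"
      using w by (auto simp: h_def power2_eq_square)
    then show ?thesis using N[OF c] by simp
  qed
  have 1: "((\<lambda>n. h n / ?w (n - 1)) has_sum hardy_norm_sq r (backward_shift r c)) UNIV"
  proof -
    have "(\<lambda>n. h (n + 1) / ?w (n + 1 - 1)) = (\<lambda>n. ?w n * (norm (backward_shift r c n))\<^sup>2)"
      using w by (auto simp: h_def backward_shift_def power_mult_distrib power_divide power2_eq_square field_simps)
    then show ?thesis
      using N[OF c1] has_sum_reindex_bij_betw[OF bij_int_add[of 1], of "\<lambda>n. h n / ?w (n - 1)"] by simp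
  qed
  have 2: "((\<lambda>n. h n / ?w (n - 2)) has_sum hardy_norm_sq r (backward_shift r (backward_shift r c))) UNIV"
  proof -
    have "(\<lambda>n. h (n + 2) / ?w (n + 2 - 2)) = (\<lambda>n. ?w n * (norm (backward_shift r (backward_shift r c) n))\<^sup>2)"
      using w by (auto simp: h_def backward_shift_def power_mult_distrib power_divide power2_eq_square field_simps)
    then show ?thesis
      using N[OF c2] has_sum_reindex_bij_betw[OF bij_int_add[of 2], of "\<lambda>n. h n / ?w (n - 2)"] by simp
  qed
  have "((\<lambda>n. (- 1) * (h n / ?w (n - 2)) + (1 + r\<^sup>2) * (h n / ?w (n - 1)) + (- (r\<^sup>2)) * (h n / ?w n))
      has_sum ((- 1) * hardy_norm_sq r (backward_shift r (backward_shift r c))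
        + (1 + r\<^sup>2) * hardy_norm_sq r (backward_shift r c) + (- (r\<^sup>2)) * hardy_norm_sq r c)) UNIV"
    by (intro has_sum_add has_sum_cmult_right 0 1 2)
  also have "(\<lambda>n. (- 1) * (h n / ?w (n - 2)) + (1 + r\<^sup>2) * (h n / ?w (n - 1)) + (- (r\<^sup>2)) * (h n / ?w n))
      = (\<lambda>n. if n = 0 then h 0 else 0)"
  proof
    fix n
    have "(- 1) * (h n / ?w (n - 2)) + (1 + r\<^sup>2) * (h n / ?w (n - 1)) + (- (r\<^sup>2)) * (h n / ?w n)
        = h n * (- 1 / ?w (n - 2) + (1 + r\<^sup>2) / ?w (n - 1) - r\<^sup>2 / ?w n)"
      by (simp add: algebra_simps)
    then show "(- 1) * (h n / ?w (n - 2)) + (1 + r\<^sup>2) * (h n / ?w (n - 1)) + (- (r\<^sup>2)) * (h n / ?w n)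
        = (if n = 0 then h 0 else 0)"
      by (simp only: hardy_weight_recurrence) simp
  qed
  finally have "((\<lambda>n::int. if n = 0 then h 0 else 0) has_sum
      (- hardy_norm_sq r (backward_shift r (backward_shift r c))
        + (1 + r\<^sup>2) * hardy_norm_sq r (backward_shift r c) - r\<^sup>2 * hardy_norm_sq r c)) UNIV"
    by simp
  moreover have "((\<lambda>n::int. if n = 0 then h 0 else 0) has_sum h 0) UNIV"
    by (rule has_sum_finite_neutralI[of "{0}"]) auto
  ultimately have "- hardy_norm_sq r (backward_shift r (backward_shift r c))
      + (1 + r\<^sup>2) * hardy_norm_sq r (backward_shift r c) - r\<^sup>2 * hardy_norm_sq r c = h 0"
    by (rule has_sum_unique)
  then show ?thesis using hardy_weight_nat[of r 0] by (simp add: h_def)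
qed

end

section \<open>The model operator and its adjoint\<close>

text \<open>The adjoint of the model operator: it can be written down explicitly, since a unitary operator
  has its inverse as adjoint.\<close>

definition model_adj ::
  "real \<Rightarrow> 'k::chilbert_space set \<Rightarrow> ('k \<Rightarrow> 'k) \<Rightarrow> 'l::chilbert_space set \<Rightarrow> ('l \<Rightarrow> 'l)
    \<Rightarrow> (complex \<Rightarrow> 'e::chilbert_space) \<times> 'k \<times> 'l \<Rightarrow> (complex \<Rightarrow> 'e) \<times> 'k \<times> 'l" where
  "model_adj r K\<^sub>0 U\<^sub>0 K\<^sub>1 U\<^sub>1 =
     map_prod (mult_z_adj r) (map_prod (inv_into K\<^sub>0 U\<^sub>0) (\<lambda>y. r *\<^sub>R inv_into K\<^sub>1 U\<^sub>1 y))"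

lemma unitary_map_inv:
  assumes U: "unitary_map (hspace_of K) (hspace_of K) U" and y: "y \<in> K"
  shows "inv_into K U y \<in> K" and "U (inv_into K U y) = y"
    and "x \<in> K \<Longrightarrow> cinner (U x) y = cinner x (inv_into K U y)"
    and "norm (inv_into K U y) = norm y"
proof -
  have bij: "bij_betw U K K" and iso: "\<And>x y. x \<in> K \<Longrightarrow> y \<in> K \<Longrightarrow> cinner (U x) (U y) = cinner x y"
    using U by (auto simp: unitary_map_def hspace_of_def)
  show i: "inv_into K U y \<in> K" "U (inv_into K U y) = y"
    using bij y by (auto simp: bij_betw_def inv_into_into f_inv_into_f)
  show "x \<in> K \<Longrightarrow> cinner (U x) y = cinner x (inv_into K U y)"
    using iso[of x "inv_into K U y"] i by simp
  have "(norm (inv_into K U y))\<^sup>2 = (norm y)\<^sup>2"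
    using iso[of "inv_into K U y" "inv_into K U y"] i by (simp add: norm_sq_cinner)
  then show "norm (inv_into K U y) = norm y" by (simp add: power2_eq_iff_nonneg)
qed

lemma model_carrier:
  "hcarrier (model_space r E K\<^sub>0 K\<^sub>1) = hcarrier (hardy_space r E) \<times> K\<^sub>0 \<times> K\<^sub>1"
  by (simp add: model_space_def direct_sum_def hspace_of_def)

lemma model_hinner:
  "hinner (model_space r E K\<^sub>0 K\<^sub>1) (g, k, l) (g', k', l')
    = hinner (hardy_space r E) g g' + (cinner k k' + cinner l l')"
  by (simp add: model_space_def direct_sum_def hspace_of_def)

lemma pre_hilbert_model_space:
  assumes "0 < r" "r < 1" and "hilbert_subset E" "hilbert_subset K\<^sub>0" "hilbert_subset K\<^sub>1"
  shows "pre_hilbert (model_space r E K\<^sub>0 K\<^sub>1)"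
  using assms unfolding model_space_def
  by (intro pre_hilbert_direct_sum pre_hilbert_hardy_space pre_hilbert_hspace_of)
    (auto simp: hilbert_subset_def)

context
  fixes r :: real and E :: "'e::chilbert_space set"
    and K\<^sub>0 :: "'k::chilbert_space set" and U\<^sub>0 and K\<^sub>1 :: "'l::chilbert_space set" and U\<^sub>1
  assumes r: "0 < r" "r < 1"
    and E: "hilbert_subset E" and K\<^sub>0: "hilbert_subset K\<^sub>0" and K\<^sub>1: "hilbert_subset K\<^sub>1"
    and U\<^sub>0: "unitary_map (hspace_of K\<^sub>0) (hspace_of K\<^sub>0) U\<^sub>0"
    and U\<^sub>1: "unitary_map (hspace_of K\<^sub>1) (hspace_of K\<^sub>1) U\<^sub>1"
begin

lemma csubspace_K: "csubspace K\<^sub>0" "csubspace K\<^sub>1"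
  using K\<^sub>0 K\<^sub>1 by (auto simp: hilbert_subset_def)

lemma model_op_closed:
  "x \<in> hcarrier (model_space r E K\<^sub>0 K\<^sub>1) \<Longrightarrow> model_op r U\<^sub>0 U\<^sub>1 x \<in> hcarrier (model_space r E K\<^sub>0 K\<^sub>1)"
  using U\<^sub>0 U\<^sub>1 csubspace_K mult_z_closed[OF r E] unfolding model_carrier
  by (auto simp: model_op_def unitary_map_def hspace_of_def scaleR_scaleC
      intro!: csubspace_scale intro: bij_betw_apply)

lemma model_adj_closed:
  "x \<in> hcarrier (model_space r E K\<^sub>0 K\<^sub>1) \<Longrightarrow>
    model_adj r K\<^sub>0 U\<^sub>0 K\<^sub>1 U\<^sub>1 x \<in> hcarrier (model_space r E K\<^sub>0 K\<^sub>1)"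
  using unitary_map_inv(1)[OF U\<^sub>0] unitary_map_inv(1)[OF U\<^sub>1] csubspace_K mult_z_adj_closed[OF r E]
  unfolding model_carrier
  by (auto simp: model_adj_def scaleR_scaleC intro!: csubspace_scale)

lemma hinner_model_op:
  assumes "x \<in> hcarrier (model_space r E K\<^sub>0 K\<^sub>1)" and "y \<in> hcarrier (model_space r E K\<^sub>0 K\<^sub>1)"
  shows "hinner (model_space r E K\<^sub>0 K\<^sub>1) (model_op r U\<^sub>0 U\<^sub>1 x) y
    = hinner (model_space r E K\<^sub>0 K\<^sub>1) x (model_adj r K\<^sub>0 U\<^sub>0 K\<^sub>1 U\<^sub>1 y)"
  using assms unitary_map_inv(3)[OF U\<^sub>0] unitary_map_inv(3)[OF U\<^sub>1] hinner_mult_z[OF r E]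
  unfolding model_carrier
  by (auto simp: model_adj_def model_op_def model_hinner cinner_scaleR_left cinner_scaleR_right)

text \<open>The part \<open>U\<^sub>0\<close> contributes the factor \<open>- 1 + (1 + r\<^sup>2) - r\<^sup>2 = 0\<close>, the part \<open>r U\<^sub>1\<close> the factor
  \<open>- r\<^sup>4 + (1 + r\<^sup>2) r\<^sup>2 - r\<^sup>2 = 0\<close>, and the Hardy space a nonnegative number by
  \<open>hardy_norm_sq_defect\<close>.\<close>

lemma model_defect_nonneg:
  fixes x
  defines "y \<equiv> model_adj r K\<^sub>0 U\<^sub>0 K\<^sub>1 U\<^sub>1 x"
  defines "z \<equiv> model_adj r K\<^sub>0 U\<^sub>0 K\<^sub>1 U\<^sub>1 y"
  assumes x: "x \<in> hcarrier (model_space r E K\<^sub>0 K\<^sub>1)"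
  shows "0 \<le> - Re (hinner (model_space r E K\<^sub>0 K\<^sub>1) z z)
    + (1 + r\<^sup>2) * Re (hinner (model_space r E K\<^sub>0 K\<^sub>1) y y)
    - r\<^sup>2 * Re (hinner (model_space r E K\<^sub>0 K\<^sub>1) x x)"
proof -
  obtain c k l where x_eq: "x = (hardy_fun r c, k, l)" and c: "c \<in> hardy_seq r UNIV"
    and k: "k \<in> K\<^sub>0" and l: "l \<in> K\<^sub>1"
    using x hardy_seq_mono unfolding model_carrier hardy_carrier[OF r E] by blast
  let ?B = "backward_shift r" and ?I = "inv_into K\<^sub>0 U\<^sub>0" and ?J = "inv_into K\<^sub>1 U\<^sub>1"
  have c1: "?B c \<in> hardy_seq r UNIV" and c2: "?B (?B c) \<in> hardy_seq r UNIV"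
    using c by (auto intro!: hardy_seq_backward_shift[OF r])
  have y: "y = (hardy_fun r (?B c), ?I k, r *\<^sub>R ?J l)"
    using c by (simp add: y_def x_eq model_adj_def mult_z_adj_hardy_fun[OF r])
  have z: "z = (hardy_fun r (?B (?B c)), ?I (?I k), r *\<^sub>R ?J (r *\<^sub>R ?J l))"
    using c1 by (simp add: z_def y model_adj_def mult_z_adj_hardy_fun[OF r])
  have J: "?J l \<in> K\<^sub>1" "r *\<^sub>R ?J l \<in> K\<^sub>1"
    using unitary_map_inv(1)[OF U\<^sub>1 l] csubspace_K by (auto simp: scaleR_scaleC csubspace_scale)
  have I: "?I k \<in> K\<^sub>0" by (rule unitary_map_inv(1)[OF U\<^sub>0 k])
  have "- Re (hinner (model_space r E K\<^sub>0 K\<^sub>1) z z)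
    + (1 + r\<^sup>2) * Re (hinner (model_space r E K\<^sub>0 K\<^sub>1) y y)
    - r\<^sup>2 * Re (hinner (model_space r E K\<^sub>0 K\<^sub>1) x x)
    = (- hardy_norm_sq r (?B (?B c)) + (1 + r\<^sup>2) * hardy_norm_sq r (?B c) - r\<^sup>2 * hardy_norm_sq r c)"
    using r unfolding x_eq y z model_hinner
    by (simp add: hinner_hardy_fun_self[OF r] c c1 c2 unitary_map_inv(4)[OF U\<^sub>0] k I
        unitary_map_inv(4)[OF U\<^sub>1] l J power_mult_distrib algebra_simps flip: norm_sq_cinner)
  then show ?thesis
    by (simp only: hardy_norm_sq_defect[OF r c] zero_le_power2)
qed

lemma compression_of_model_iff:
  fixes T :: "'a::chilbert_space \<Rightarrow> 'a"
  assumes T: "bounded_clinear T"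
  shows "compression_of_model r (adj T) E K\<^sub>0 U\<^sub>0 K\<^sub>1 U\<^sub>1 \<longleftrightarrow>
    (\<exists>V. (\<forall>x. V x \<in> hcarrier (model_space r E K\<^sub>0 K\<^sub>1)) \<and>
      (\<forall>x y. V (x + y) = V x + V y) \<and> (\<forall>c x. V (c *\<^sub>C x) = c *\<^sub>C V x) \<and>
      (\<forall>x y. hinner (model_space r E K\<^sub>0 K\<^sub>1) (V x) (V y) = cinner x y) \<and>
      (\<forall>x. V (T x) = model_adj r K\<^sub>0 U\<^sub>0 K\<^sub>1 U\<^sub>1 (V x)))"
  using pre_hilbert.compression_iff_intertwining_isometry[OF pre_hilbert_model_space[OF r E K\<^sub>0 K\<^sub>1] T
      model_op_closed model_adj_closed hinner_model_op] E K\<^sub>0 K\<^sub>1 U\<^sub>0 U\<^sub>1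
  by (simp add: compression_of_model_def Let_def)

end

section \<open>The defect of an operator\<close>

definition defect :: "real \<Rightarrow> ('a::chilbert_space \<Rightarrow> 'a) \<Rightarrow> 'a \<Rightarrow> real" where
  "defect r T x = - (norm (T (T x)))\<^sup>2 + (1 + r\<^sup>2) * (norm (T x))\<^sup>2 - r\<^sup>2 * (norm x)\<^sup>2"

lemma positive_alpha_op_iff:
  fixes T :: "'a::chilbert_space \<Rightarrow> 'a"
  assumes T: "bounded_clinear T"
  shows "positive_op (alpha_op r T) \<longleftrightarrow> (\<forall>x. 0 \<le> defect r T x)"
proof -
  have adj: "cinner (adj T y) x = cinner y (T x)" for x y
    using cinner_adj[OF T, of x y] by (metis cinner_commute)
  have "cinner (alpha_op r T x) x = complex_of_real (defect r T x)" for x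
    by (simp add: alpha_op_def defect_def cinner.expand cinner_scaleR_left adj cinner_norm)
  then show ?thesis by (simp add: positive_op_def)
qed

text \<open>The isometry \<open>V\<close> carries the defect of \<open>T\<close> at \<open>x\<close> to that of the adjoint of the model operator
  at \<open>V x\<close>.\<close>

lemma defect_nonneg_of_compression:
  fixes T :: "'a::chilbert_space \<Rightarrow> 'a"
    and E :: "'e::chilbert_space set" and K\<^sub>0 :: "'k::chilbert_space set"
    and K\<^sub>1 :: "'l::chilbert_space set"
  assumes r: "0 < r" "r < 1" and T: "bounded_clinear T"
    and model: "compression_of_model r (adj T) E K\<^sub>0 U\<^sub>0 K\<^sub>1 U\<^sub>1"
  shows "0 \<le> defect r T x"
proof -
  have h: "hilbert_subset E" "hilbert_subset K\<^sub>0" "hilbert_subset K\<^sub>1"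
    "unitary_map (hspace_of K\<^sub>0) (hspace_of K\<^sub>0) U\<^sub>0" "unitary_map (hspace_of K\<^sub>1) (hspace_of K\<^sub>1) U\<^sub>1"
    using model by (auto simp: compression_of_model_def)
  obtain V where V: "\<And>x. V x \<in> hcarrier (model_space r E K\<^sub>0 K\<^sub>1)"
    "\<And>x y. hinner (model_space r E K\<^sub>0 K\<^sub>1) (V x) (V y) = cinner x y"
    "\<And>x. model_adj r K\<^sub>0 U\<^sub>0 K\<^sub>1 U\<^sub>1 (V x) = V (T x)"
    using model unfolding compression_of_model_iff[OF r h T] by metis
  show ?thesis
    using model_defect_nonneg[OF r h V(1)[of x]] by (simp add: V defect_def norm_sq_cinner)
qed

lemma nonneg_seq_increment:
  fixes u :: "nat \<Rightarrow> real"
  assumes "\<And>k. 0 \<le> u k" and step: "\<And>k. u (Suc k) \<le> u k + e"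
  shows "0 \<le> e"
proof (rule ccontr)
  assume e: "\<not> 0 \<le> e"
  have u: "u k \<le> u 0 + real k * e" for k
  proof (induction k)
    case (Suc k)
    then show ?case using step[of k] by (simp add: algebra_simps)
  qed simp
  obtain k :: nat where "u 0 / - e < real k" using reals_Archimedean2 by blast
  then have "u 0 + real k * e < 0" using e by (simp add: field_simps)
  then show False using u[of k] assms(1)[of k] by simp
qed

text \<open>With \<open>a\<^sub>k = \<parallel>T\<^sup>k x\<parallel>\<^sup>2\<close> the numbers \<open>a\<^bsub>k+1\<^esub> - r\<^sup>2 a\<^sub>k\<close> decrease. If the first one were negative,
  the nonnegative sequence \<open>a\<^sub>k\<close> would drop by at least a fixed amount in every step.\<close>

lemma lower_bound_of_defect:
  fixes T :: "'a::chilbert_space \<Rightarrow> 'a"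
  assumes r: "0 < r" "r < 1" and d: "\<And>x. 0 \<le> defect r T x"
  shows "r\<^sup>2 * (norm x)\<^sup>2 \<le> (norm (T x))\<^sup>2"
proof -
  let ?a = "\<lambda>k. (norm ((T ^^ k) x))\<^sup>2"
  have le: "?a (Suc k) - r\<^sup>2 * ?a k \<le> ?a (Suc 0) - r\<^sup>2 * ?a 0" for k
  proof (induction k)
    case (Suc k)
    then show ?case using d[of "(T ^^ k) x"] by (simp add: defect_def algebra_simps)
  qed simp
  have "0 \<le> (norm (T x))\<^sup>2 - r\<^sup>2 * (norm x)\<^sup>2"
  proof (rule nonneg_seq_increment[of ?a])
    fix k
    have "r\<^sup>2 * ?a k \<le> 1 * ?a k"
      using r by (intro mult_right_mono) (auto simp: power_le_one)
    then show "?a (Suc k) \<le> ?a k + ((norm (T x))\<^sup>2 - r\<^sup>2 * (norm x)\<^sup>2)"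
      using le[of k] by simp
  qed simp
  then show ?thesis by simp
qed

text \<open>The same argument in the backward direction, along the orbit of \<open>x\<close> under the right inverse
  \<open>S\<close>: if \<open>b(x) = \<parallel>x\<parallel>\<^sup>2 - \<parallel>T x\<parallel>\<^sup>2\<close> were negative, then \<open>b(S\<^sup>k x) \<le> b(x)\<close> for all \<open>k\<close>.\<close>

lemma contraction_of_defect:
  fixes T S :: "'a::chilbert_space \<Rightarrow> 'a"
  assumes r: "0 < r" "r < 1" and d: "\<And>x. 0 \<le> defect r T x" and TS: "\<And>x. T (S x) = x"
  shows "norm (T x) \<le> norm x"
proof -
  define b where "b y = (norm y)\<^sup>2 - (norm (T y))\<^sup>2" for y
  have b: "r\<^sup>2 * b y \<le> b (T y)" for y
    using d[of y] by (simp add: defect_def b_def algebra_simps)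
  have "0 \<le> b x"
  proof (rule ccontr)
    assume neg: "\<not> 0 \<le> b x"
    have le: "b ((S ^^ k) x) \<le> b x" for k
    proof (induction k)
      case (Suc k)
      have "r\<^sup>2 * b ((S ^^ Suc k) x) \<le> b x"
        using b[of "(S ^^ Suc k) x"] Suc by (simp add: TS)
      moreover have "b x \<le> r\<^sup>2 * b x"
        using mult_right_mono_neg[of "r\<^sup>2" 1 "b x"] neg r by (simp add: power_le_one)
      ultimately have "r\<^sup>2 * b ((S ^^ Suc k) x) \<le> r\<^sup>2 * b x" by linarith
      then show ?case using r by (simp add: mult_le_cancel_left)
    qed simp
    have "0 \<le> b x"
    proof (rule nonneg_seq_increment[of "\<lambda>k. (norm ((S ^^ k) x))\<^sup>2"])
      show "(norm ((S ^^ Suc k) x))\<^sup>2 \<le> (norm ((S ^^ k) x))\<^sup>2 + b x" for k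
        using le[of "Suc k"] by (simp add: b_def TS)
    qed simp
    with neg show False by simp
  qed
  then show ?thesis by (simp add: b_def)
qed

lemma defect_factorization:
  fixes T :: "'a::chilbert_space \<Rightarrow> 'a"
  assumes T: "bounded_clinear T" and d: "\<And>x. 0 \<le> defect r T x"
    and contr: "\<And>x. norm (T x) \<le> norm x"
  obtains D where "bounded_clinear D" and "\<And>x. (norm (D x))\<^sup>2 = defect r T x"
proof -
  define f where "f x y = - cinner (T (T x)) (T (T y)) + of_real (1 + r\<^sup>2) * cinner (T x) (T y)
    - of_real (r\<^sup>2) * cinner x y" for x y
  have Re_f: "Re (f x x) = defect r T x" for x
    by (simp add: f_def defect_def norm_sq_cinner)
  obtain D where D: "bounded_clinear D" "\<And>x y. f x y = cinner (D x) (D y)"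
  proof (rule bounded_psd_form_factorization[of f "1 + r\<^sup>2"])
    show "psd_form UNIV f"
    proof
      show "f x y = cnj (f y x)" for x y
        by (simp add: f_def flip: cinner_commute)
      show "0 \<le> Re (f x x)" for x
        using d Re_f by simp
    qed (simp_all add: f_def bounded_clinear_imp[OF T] cinner.expand algebra_simps)
    show "Re (f x x) \<le> (1 + r\<^sup>2) * (norm x)\<^sup>2" for x
    proof -
      have "(1 + r\<^sup>2) * (norm (T x))\<^sup>2 \<le> (1 + r\<^sup>2) * (norm x)\<^sup>2"
        using contr[of x] by (intro mult_left_mono power_mono) auto
      moreover have "0 \<le> r\<^sup>2 * (norm x)\<^sup>2" by simp
      ultimately show ?thesis
        using zero_le_power2[of "norm (T (T x))"] unfolding Re_f defect_def by linarith
    qed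
  qed blast
  have "(norm (D x))\<^sup>2 = defect r T x" for x
    using Re_f[of x] by (simp add: D(2) norm_sq_cinner)
  with D(1) that show thesis by blast
qed

section \<open>The model embedding\<close>

definition int_pow :: "('a \<Rightarrow> 'a) \<Rightarrow> ('a \<Rightarrow> 'a) \<Rightarrow> int \<Rightarrow> 'a \<Rightarrow> 'a" where
  "int_pow T S n = (if n \<ge> 0 then T ^^ nat n else S ^^ nat (- n))"

lemma int_pow_nat [simp]: "int_pow T S (int k) = T ^^ k"
  and int_pow_neg [simp]: "int_pow T S (- int k - 1) = S ^^ Suc k"
proof -
  have "nat (1 + int k) = Suc k" by simp
  then show "int_pow T S (- int k - 1) = S ^^ Suc k"
    unfolding int_pow_def by (simp add: algebra_simps del: funpow.simps)
qed (simp add: int_pow_def)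

lemma int_pow_shift:
  assumes ST: "\<And>x. S (T x) = x"
  shows "int_pow T S n (T x) = int_pow T S (n + 1) x"
proof (cases "n \<ge> 0")
  case True
  then obtain k where k: "n = int k" using nonneg_int_cases by blast
  have "n + 1 = int (Suc k)" using k by simp
  then show ?thesis unfolding k by (simp only: int_pow_nat) (simp add: funpow_swap1)
next
  case False
  then obtain k where k: "n = - int k - 1"
    by (intro that[of "nat (- n - 1)"]) auto
  show ?thesis
  proof (cases k)
    case 0
    then show ?thesis using k int_pow_neg[of T S 0] int_pow_nat[of T S 0] by (simp add: ST)
  next
    case (Suc j)
    have "n + 1 = - int j - 1" using k Suc by simp
    then show ?thesis
      unfolding k by (simp only: int_pow_neg) (simp add: Suc funpow_swap1 ST)
  qed
qed

lemma int_pow_clinear: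
  assumes "bounded_clinear T" and "bounded_clinear S"
  shows "int_pow T S n (x + y) = int_pow T S n x + int_pow T S n y"
    and "int_pow T S n (c *\<^sub>C x) = c *\<^sub>C int_pow T S n x"
  by (simp_all add: int_pow_def funpow_clinear assms)

lemma funpow_scaleR_clinear:
  fixes S :: "'a::chilbert_space \<Rightarrow> 'a"
  assumes "bounded_clinear S"
  shows "((\<lambda>x. r *\<^sub>R S x) ^^ k) x = r ^ k *\<^sub>R (S ^^ k) x"
  by (induction k) (simp_all add: bounded_clinear_imp[OF assms] scaleR_scaleC scaleC_scaleC
      scaleC_one mult.commute)

text \<open>Both halves of the series telescope: with \<open>a\<^sub>n = \<parallel>T\<^sup>n x\<parallel>\<^sup>2\<close> the defect of \<open>T\<^sup>n x\<close> is
  \<open>(a\<^bsub>n+1\<^esub> - r\<^sup>2 a\<^sub>n) - (a\<^bsub>n+2\<^esub> - r\<^sup>2 a\<^bsub>n+1\<^esub>)\<close>, and \<open>r\<^sup>2\<^sup>k\<close> times the defect of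
  \<open>T\<^sup>-\<^sup>k\<^sup>-\<^sup>1 x\<close> is the difference of the numbers \<open>r\<^sup>2\<^sup>k (a\<^bsub>-k\<^esub> - a\<^bsub>1-k\<^esub>)\<close> for \<open>k\<close> and \<open>k + 1\<close>.\<close>

lemma hardy_norm_sq_orbit:
  fixes T S :: "'a::chilbert_space \<Rightarrow> 'a"
  assumes r: "0 < r" "r < 1" and TS: "\<And>x. T (S x) = x"
    and D: "\<And>x. (norm (D x))\<^sup>2 = defect r T x"
    and L0: "(\<lambda>k. (norm ((T ^^ k) x))\<^sup>2) \<longlonglongrightarrow> L0"
    and L1: "(\<lambda>k. r ^ (2 * k) * (norm ((S ^^ k) x))\<^sup>2) \<longlonglongrightarrow> L1"
  shows "((\<lambda>n. (norm (D (int_pow T S n x)))\<^sup>2 / hardy_weight r n) has_sum ((norm x)\<^sup>2 - L0 - L1)) UNIV"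
proof -
  have r2: "0 < 1 - r\<^sup>2" by (rule one_minus_r_sq[OF r])
  define a where "a k = (norm ((T ^^ k) x))\<^sup>2" for k
  define p where "p k = (norm ((S ^^ k) x))\<^sup>2" for k
  have "((\<lambda>k. (norm (D ((T ^^ k) x)))\<^sup>2) has_sum ((a 1 - r\<^sup>2 * a 0) - (L0 - r\<^sup>2 * L0))) UNIV"
  proof (rule sums_nonneg_imp_has_sum)
    define e where "e k = - (a (Suc k) - r\<^sup>2 * a k)" for k
    have "(\<lambda>k. e (Suc k) - e k) sums (- (L0 - r\<^sup>2 * L0) - e 0)"
      unfolding e_def a_def
      by (intro telescope_sums tendsto_intros L0 LIMSEQ_Suc[OF L0])
    moreover have "e (Suc k) - e k = (norm (D ((T ^^ k) x)))\<^sup>2" for k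
      by (simp add: D e_def a_def defect_def algebra_simps)
    moreover have "- (L0 - r\<^sup>2 * L0) - e 0 = (a 1 - r\<^sup>2 * a 0) - (L0 - r\<^sup>2 * L0)"
      by (simp add: e_def)
    ultimately show "(\<lambda>k. (norm (D ((T ^^ k) x)))\<^sup>2) sums ((a 1 - r\<^sup>2 * a 0) - (L0 - r\<^sup>2 * L0))"
      by (simp only:)
  qed simp
  from has_sum_divide_const[OF this, of "1 - r\<^sup>2"]
  have pos: "((\<lambda>k. (norm (D (int_pow T S (int k) x)))\<^sup>2 / hardy_weight r (int k)) has_sum
      ((a 1 - r\<^sup>2 * a 0) - (L0 - r\<^sup>2 * L0)) / (1 - r\<^sup>2)) UNIV"
    by (simp add: hardy_weight_nat)
  have "((\<lambda>k. r ^ (2 * k) * (norm (D ((S ^^ Suc k) x)))\<^sup>2) has_sum ((a 0 - a 1) - (L1 - r\<^sup>2 * L1))) UNIV"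
  proof (rule sums_nonneg_imp_has_sum)
    define e where "e k = - (r ^ (2 * k) * (p k - (norm (T ((S ^^ k) x)))\<^sup>2))" for k
    have "(\<lambda>k. - (r ^ (2 * Suc k) * p (Suc k) - r\<^sup>2 * (r ^ (2 * k) * p k))) \<longlonglongrightarrow> - (L1 - r\<^sup>2 * L1)"
      unfolding p_def by (intro tendsto_intros L1 LIMSEQ_Suc[OF L1])
    moreover have "- (r ^ (2 * Suc k) * p (Suc k) - r\<^sup>2 * (r ^ (2 * k) * p k)) = e (Suc k)" for k
      by (simp add: e_def p_def TS power2_eq_square algebra_simps)
    ultimately have "(\<lambda>k. e (Suc k)) \<longlonglongrightarrow> - (L1 - r\<^sup>2 * L1)" by simp
    then have "e \<longlonglongrightarrow> - (L1 - r\<^sup>2 * L1)" by (simp only: filterlim_sequentially_Suc)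
    then have "(\<lambda>k. e (Suc k) - e k) sums (- (L1 - r\<^sup>2 * L1) - e 0)"
      by (rule telescope_sums)
    moreover have "e (Suc k) - e k = r ^ (2 * k) * (norm (D ((S ^^ Suc k) x)))\<^sup>2" for k
    proof -
      have "(norm (D ((S ^^ Suc k) x)))\<^sup>2 = - (norm (T ((S ^^ k) x)))\<^sup>2 + (1 + r\<^sup>2) * p k - r\<^sup>2 * p (Suc k)"
        by (simp add: D defect_def TS p_def)
      moreover have "r ^ (2 * Suc k) = r ^ (2 * k) * r\<^sup>2"
        by (simp add: power2_eq_square)
      moreover have "(norm (T ((S ^^ Suc k) x)))\<^sup>2 = p k"
        by (simp add: TS p_def)
      ultimately show ?thesis
        unfolding e_def by (simp only:) (simp add: algebra_simps)
    qed
    moreover have "- (L1 - r\<^sup>2 * L1) - e 0 = (a 0 - a 1) - (L1 - r\<^sup>2 * L1)"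
      by (simp add: e_def a_def p_def)
    ultimately show "(\<lambda>k. r ^ (2 * k) * (norm (D ((S ^^ Suc k) x)))\<^sup>2) sums ((a 0 - a 1) - (L1 - r\<^sup>2 * L1))"
      by (simp only:)
  qed (use r in simp)
  note sum_neg = has_sum_divide_const[OF this, of "1 - r\<^sup>2"]
  have "r ^ (2 * k) * X / (1 - r\<^sup>2) = X / ((1 - r\<^sup>2) / (r\<^sup>2) ^ k)" for k X
    by (simp add: power_mult)
  with sum_neg have neg: "((\<lambda>k. (norm (D (int_pow T S (- int k - 1) x)))\<^sup>2 / hardy_weight r (- int k - 1)) has_sum
      ((a 0 - a 1) - (L1 - r\<^sup>2 * L1)) / (1 - r\<^sup>2)) UNIV"
    by (simp only: hardy_weight_neg[OF r] int_pow_neg)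
  have "((a 1 - r\<^sup>2 * a 0) - (L0 - r\<^sup>2 * L0)) / (1 - r\<^sup>2) + ((a 0 - a 1) - (L1 - r\<^sup>2 * L1)) / (1 - r\<^sup>2)
      = ((1 - r\<^sup>2) * (a 0 - L0 - L1)) / (1 - r\<^sup>2)"
    unfolding add_divide_distrib[symmetric] by (simp add: algebra_simps)
  also have "\<dots> = (norm x)\<^sup>2 - L0 - L1"
    using r2 by (simp add: a_def)
  finally show ?thesis
    using has_sum_int_split[OF pos neg] by simp
qed

text \<open>The embedding is \<open>V x = (g, C\<^sub>0 x, C\<^sub>1 x)\<close>, where \<open>g\<close> has the Laurent coefficients
  \<open>D T\<^sup>n x / w\<^sub>n\<close>; dividing by the weight turns the adjoint of \<open>M\<^sub>z\<close> into the shift of the orbit.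
  The last two components supply the two limits missing in the norm of \<open>g\<close>, and \<open>T\<close> acts on them
  as a unitary operator and as \<open>r\<close> times a unitary operator.\<close>

lemma compression_of_model_exists:
  fixes T :: "'a::chilbert_space \<Rightarrow> 'a"
  assumes r: "0 < r" "r < 1" and inv: "invertible_op T" and d: "\<And>x. 0 \<le> defect r T x"
  shows "\<exists>(K\<^sub>0 :: 'a set) U\<^sub>0 (K\<^sub>1 :: 'a set) U\<^sub>1.
    compression_of_model r (adj T) (UNIV :: 'a set) K\<^sub>0 U\<^sub>0 K\<^sub>1 U\<^sub>1"
proof -
  obtain S where T: "bounded_clinear T" and S: "bounded_clinear S"
    and ST: "\<And>x. S (T x) = x" and TS: "\<And>x. T (S x) = x"
    using inv by (auto simp: invertible_op_def fun_eq_iff)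
  have contr: "norm (T x) \<le> norm x" for x
    using r d TS by (rule contraction_of_defect)
  obtain D where D: "bounded_clinear D" "\<And>x. (norm (D x))\<^sup>2 = defect r T x"
    using defect_factorization[OF T d contr] by blast
  \<comment> \<open>The contraction \<open>r T\<^sup>-\<^sup>1\<close>, whose asymptotic limit is \<open>C\<^sub>1\<close>, and its inverse.\<close>
  define R where "R x = r *\<^sub>R S x" for x
  define R' where "R' x = (1 / r) *\<^sub>R T x" for x
  have R: "bounded_clinear R" "bounded_clinear R'"
    using T S unfolding bounded_clinear_def R_def R'_def
    by (auto intro!: bounded_linear_intros simp: scaleC_scaleR_commute bounded_linear_const_scaleR)
  have RR': "R (R' x) = x" "R' (R x) = x" for x
    using r by (simp_all add: R_def R'_def scaleR_scaleC bounded_clinear_imp[OF T]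
        bounded_clinear_imp[OF S] scaleC_scaleC ST TS scaleC_one)
  have R_contr: "norm (R x) \<le> norm x" for x
  proof (rule power2_le_imp_le)
    show "(norm (R x))\<^sup>2 \<le> (norm x)\<^sup>2"
      using lower_bound_of_defect[OF r d, of "S x"] by (simp add: TS R_def power_mult_distrib)
  qed simp
  obtain C0 where C0: "bounded_clinear C0"
    and lim0: "\<And>x. (\<lambda>n. (norm ((T ^^ n) x))\<^sup>2) \<longlonglongrightarrow> (norm (C0 x))\<^sup>2"
    using contraction_asymptotic_limit[OF T contr] by blast
  obtain C1 where C1: "bounded_clinear C1"
    and lim1: "\<And>x. (\<lambda>n. (norm ((R ^^ n) x))\<^sup>2) \<longlonglongrightarrow> (norm (C1 x))\<^sup>2"
    using contraction_asymptotic_limit[OF R(1) R_contr] by blast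
  have C0T: "norm (C0 (T x)) = norm (C0 x)" for x
  proof -
    have "(norm (C0 (T x)))\<^sup>2 = (norm (C0 x))\<^sup>2"
      using lim0[of "T x"] LIMSEQ_Suc[OF lim0[of x]]
      by (intro LIMSEQ_unique) (simp_all add: funpow_swap1)
    then show ?thesis by (simp add: power2_eq_iff_nonneg)
  qed
  have C1R: "norm (C1 (R x)) = norm (C1 x)" for x
  proof -
    have "(norm (C1 (R x)))\<^sup>2 = (norm (C1 x))\<^sup>2"
      using lim1[of "R x"] LIMSEQ_Suc[OF lim1[of x]]
      by (intro LIMSEQ_unique) (simp_all add: funpow_swap1)
    then show ?thesis by (simp add: power2_eq_iff_nonneg)
  qed
  have C0S: "norm (C0 (S x)) = norm (C0 x)" for x
    using C0T[of "S x"] by (simp add: TS)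
  let ?K\<^sub>0 = "closure (range C0)" and ?K\<^sub>1 = "closure (range C1)"
  obtain U\<^sub>0 where U\<^sub>0: "unitary_map (hspace_of ?K\<^sub>0) (hspace_of ?K\<^sub>0) U\<^sub>0" "\<And>x. U\<^sub>0 (C0 x) = C0 (S x)"
    using unitary_on_range_closure[OF C0 S T ST TS C0S] by blast
  obtain U\<^sub>1 where U\<^sub>1: "unitary_map (hspace_of ?K\<^sub>1) (hspace_of ?K\<^sub>1) U\<^sub>1" "\<And>x. U\<^sub>1 (C1 x) = C1 (R x)"
    using unitary_on_range_closure[OF C1 R RR' C1R] by blast
  have K: "hilbert_subset ?K\<^sub>0" "hilbert_subset ?K\<^sub>1" "hilbert_subset (UNIV :: 'a set)"
    using hilbert_subset_range_closure C0 C1 by (auto simp: hilbert_subset_def)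
  have in_K: "C0 x \<in> ?K\<^sub>0" "C1 x \<in> ?K\<^sub>1" for x
    using closure_subset[of "range C0"] closure_subset[of "range C1"] by auto
  have inv0: "inv_into ?K\<^sub>0 U\<^sub>0 (C0 x) = C0 (T x)" for x
    using U\<^sub>0 in_K(1)[of "T x"] ST inv_into_f_f[of U\<^sub>0 ?K\<^sub>0 "C0 (T x)"]
    by (simp add: unitary_map_def bij_betw_def hspace_of_def)
  have inv1: "inv_into ?K\<^sub>1 U\<^sub>1 (C1 x) = C1 (R' x)" for x
    using U\<^sub>1 in_K(2)[of "R' x"] RR' inv_into_f_f[of U\<^sub>1 ?K\<^sub>1 "C1 (R' x)"]
    by (simp add: unitary_map_def bij_betw_def hspace_of_def)
  define c where "c x n = (1 / hardy_weight r n) *\<^sub>R D (int_pow T S n x)" for x n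
  have w: "0 < hardy_weight r n" for n by (rule hardy_weight_pos[OF r])
  have c_sum: "((\<lambda>n. hardy_weight r n * (norm (c x n))\<^sup>2) has_sum
      ((norm x)\<^sup>2 - (norm (C0 x))\<^sup>2 - (norm (C1 x))\<^sup>2)) UNIV" for x
  proof -
    have "(\<lambda>k. r ^ (2 * k) * (norm ((S ^^ k) x))\<^sup>2) \<longlonglongrightarrow> (norm (C1 x))\<^sup>2"
      using lim1[of x] r
      by (simp add: R_def[abs_def] funpow_scaleR_clinear[OF S] power_mult_distrib power_mult[symmetric] mult.commute)
    from hardy_norm_sq_orbit[OF r TS D(2) lim0 this]
    have "((\<lambda>n. (norm (D (int_pow T S n x)))\<^sup>2 / hardy_weight r n) has_sum
      ((norm x)\<^sup>2 - (norm (C0 x))\<^sup>2 - (norm (C1 x))\<^sup>2)) UNIV" .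
    moreover have "hardy_weight r n * (norm (c x n))\<^sup>2 = (norm (D (int_pow T S n x)))\<^sup>2 / hardy_weight r n" for n
      using w[of n] by (simp add: c_def power_mult_distrib power_divide power2_eq_square)
    ultimately show ?thesis by simp
  qed
  have c: "c x \<in> hardy_seq r UNIV" for x
    using has_sum_imp_summable[OF c_sum[of x]] by (simp add: hardy_seq_def)
  define V where "V x = (hardy_fun r (c x), C0 x, C1 x)" for x
  let ?H = "model_space r (UNIV :: 'a set) ?K\<^sub>0 ?K\<^sub>1"
  interpret H: pre_hilbert ?H
    by (rule pre_hilbert_model_space[OF r K(3,1,2)])
  have V: "V x \<in> hcarrier ?H" for x
    using c in_K by (simp add: V_def model_carrier hardy_carrier[OF r K(3)])
  have V_add: "V (x + y) = V x + V y" for x y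
  proof -
    have "c (x + y) = c x + c y"
      by (simp add: c_def fun_eq_iff int_pow_clinear[OF T S] bounded_clinear_imp[OF D(1)] scaleR_add_right)
    then show ?thesis
      by (simp add: V_def hardy_fun_add[OF r c c] bounded_clinear_imp[OF C0] bounded_clinear_imp[OF C1])
  qed
  have V_scale: "V (a *\<^sub>C x) = a *\<^sub>C V x" for a x
  proof -
    have "c (a *\<^sub>C x) = a *\<^sub>C c x"
      by (simp add: c_def fun_eq_iff scaleC_apply int_pow_clinear[OF T S] bounded_clinear_imp[OF D(1)]
          scaleC_scaleR_commute)
    then show ?thesis
      by (simp add: V_def hardy_fun_scale[OF r c] bounded_clinear_imp[OF C0] bounded_clinear_imp[OF C1]
          scaleC_prod_def)
  qed
  have V_self: "hinner ?H (V x) (V x) = cinner x x" for x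
  proof -
    have "hardy_norm_sq r (c x) = (norm x)\<^sup>2 - (norm (C0 x))\<^sup>2 - (norm (C1 x))\<^sup>2"
      unfolding hardy_norm_sq_def by (rule infsumI[OF c_sum])
    then show ?thesis
      by (simp add: V_def model_hinner hinner_hardy_fun_self[OF r c] cinner_norm)
  qed
  have V_diff: "V (x - y) = V x - V y" for x y
    using V_add[of "x - y" y] by (simp add: algebra_simps)
  have V_iso: "hinner ?H (V x) (V y) = cinner x y" for x y
  proof -
    have "4 * hinner ?H (V x) (V y) = 4 * cinner x y"
      unfolding H.polarization[OF V V] cinner.polarization[OF UNIV_I UNIV_I]
      by (simp only: V_self flip: V_add V_diff V_scale)
    then show ?thesis by simp
  qed
  have "V (T x) = model_adj r ?K\<^sub>0 U\<^sub>0 ?K\<^sub>1 U\<^sub>1 (V x)" for x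
  proof -
    have "c (T x) = backward_shift r (c x)"
      using w by (simp add: c_def backward_shift_def fun_eq_iff int_pow_shift[of S T, OF ST] less_imp_neq[symmetric])
    moreover have "r *\<^sub>R C1 (R' x) = C1 (T x)"
      using r by (simp add: R'_def scaleR_scaleC bounded_clinear_imp[OF C1] scaleC_scaleC scaleC_one)
    ultimately show ?thesis
      by (simp add: V_def model_adj_def mult_z_adj_hardy_fun[OF r c] inv0 inv1)
  qed
  then have "compression_of_model r (adj T) (UNIV :: 'a set) ?K\<^sub>0 U\<^sub>0 ?K\<^sub>1 U\<^sub>1"
    unfolding compression_of_model_iff[OF r K(3,1,2) U\<^sub>0(1) U\<^sub>1(1) T]
    using V V_add V_scale V_iso by blast
  then show ?thesis by blast
qed

theorem theorem3p2:
  fixes r :: real and T :: "'a::chilbert_space \<Rightarrow> 'a"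
  assumes "0 < r" and "r < 1" and "invertible_op T"
  shows "(T \<in> C_alpha r \<longleftrightarrow>
      (\<exists>(E :: 'a set) (K\<^sub>0 :: 'a set) U\<^sub>0 (K\<^sub>1 :: 'a set) U\<^sub>1.
         compression_of_model r (adj T) E K\<^sub>0 U\<^sub>0 K\<^sub>1 U\<^sub>1)) \<and>
    (\<forall>(E :: 'e::chilbert_space set) (K\<^sub>0 :: 'k::chilbert_space set) U\<^sub>0
        (K\<^sub>1 :: 'l::chilbert_space set) U\<^sub>1.
       compression_of_model r (adj T) E K\<^sub>0 U\<^sub>0 K\<^sub>1 U\<^sub>1 \<longrightarrow> T \<in> C_alpha r)"
proof -
  have T: "bounded_clinear T" using assms(3) by (simp add: invertible_op_def)
  have iff: "T \<in> C_alpha r \<longleftrightarrow> (\<forall>x. 0 \<le> defect r T x)"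
    using assms(3) by (simp add: C_alpha_def positive_alpha_op_iff[OF T])
  show ?thesis
    unfolding iff
    using compression_of_model_exists[OF assms] defect_nonneg_of_compression[OF assms(1,2) T]
    by meson
qed

end
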